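(* Let $\mathcal{G}$ be a connected edge-weighted graph (as in the context) whose completion $\overline{\mathcal{G}}$ is weakly connected and compact. Then every continuous function $F:\partial\overline{\mathcal{G}}\to\mathbb{R}$ has a unique extension to a continuous function $f:\overline{\mathcal{G}}\to\mathbb{R}$ that is harmonic on $\mathcal{G}$.
   Context: Graphs. $\mathcal{G}$ is a simple graph with countable vertex set $\mathcal{V}$ and countable edge set $\mathcal{E}$; each vertex has at least one and at most finitely many incident edges. Each edge $[u,v]\in\mathcal{E}$ has a length (resistance) $R(u,v)=R(v,u)\in(0,\infty)$; the conductance is $C(u,v)=1/R(u,v)$ for edges and $C(u,v)=0$ otherwise. $u\sim v$ means $[u,v]\in\mathcal{E}$. Metric and completion. A finite path from $u$ to $v$ is a finite sequence of vertices $u=v_0,v_1,\dots,v_K=v$ with $[v_k,v_{k+1}]\in\mathcal{E}$. $\mathcal{G}$ is connected if any two vertices are joined by a finite path. On vertices, $d(u,v)=\inf_\gamma\sum_k R(v_k,v_{k+1})$, the infimum over finite paths $\gamma$ from $u$ to $v$. As a metric space $\mathcal{G}$ is identified with its vertex set, and $\overline{\mathcal{G}}$ is the metric completion. Paths in the completion. A path is a sequence $\{v_k\}$ of vertices with $[v_k,v_{k+1}]\in\mathcal{E}$, indexed by a finite set, by the positive integers (a ray), or by the integers (a double ray). It goes from $u\in\overline{\mathcal{G}}$ to $v\in\overline{\mathcal{G}}$ if it starts at $u$ (or, when infinite in that direction, converges to $u$ in $d$) and ends at $v$ (or, when infinite in that direction, converges to $v$ in $d$). Weakly connected. $\overline{\mathcal{G}}$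 is weakly connected if for every pair of distinct points $u,v\in\overline{\mathcal{G}}$ there is a finite set $W$ of edges such that every path from $u$ to $v$ contains an edge from $W$. Harmonic functions. $\mathcal{V}_{int}$ is the set of vertices of degree at least $2$, and $\partial\overline{\mathcal{G}}=\overline{\mathcal{G}}\setminus\mathcal{V}_{int}$. A function $f$ is harmonic on $\mathcal{G}$ if $f(v)=\frac{1}{\sum_{u\sim v}C(u,v)}\sum_{u\sim v}C(u,v)f(u)$ for all $v\in\mathcal{V}_{int}$.
   Formalization: The boundary of the completion is additionally assumed to be nonempty; when it is empty (for example for a finite cycle) every constant function is a continuous harmonic extension, so uniqueness fails. *)

theory Defs
  imports "HOL-Analysis.Analysis"
begin

definition weighted_graph :: "'v set \<Rightarrow> 'v set set \<Rightarrow> ('v \<Rightarrow> 'v \<Rightarrow> real) \<Rightarrow> bool" where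
  "weighted_graph V E R \<longleftrightarrow>
     countable V \<and> countable E \<and>
     (\<forall>e\<in>E. \<exists>u\<in>V. \<exists>v\<in>V. u \<noteq> v \<and> e = {u, v}) \<and>
     (\<forall>v\<in>V. {e \<in> E. v \<in> e} \<noteq> {} \<and> finite {e \<in> E. v \<in> e}) \<and>
     (\<forall>u v. {u, v} \<in> E \<longrightarrow> R u v = R v u \<and> 0 < R u v)"

definition conductance :: "'v set set \<Rightarrow> ('v \<Rightarrow> 'v \<Rightarrow> real) \<Rightarrow> 'v \<Rightarrow> 'v \<Rightarrow> real" where
  "conductance E R u v = (if {u, v} \<in> E then 1 / R u v else 0)"

definition neighbours :: "'v set set \<Rightarrow> 'v \<Rightarrow> 'v set" where
  "neighbours E v = {u. {u, v} \<in> E}"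

definition degree :: "'v set set \<Rightarrow> 'v \<Rightarrow> nat" where
  "degree E v = card {e \<in> E. v \<in> e}"

text \<open>A finite path with \<open>K\<close> edges visits \<open>p 0, \<dots>, p K\<close>; values of \<open>p\<close> beyond \<open>K\<close> are irrelevant.\<close>

definition finite_path :: "'v set \<Rightarrow> 'v set set \<Rightarrow> nat \<Rightarrow> (nat \<Rightarrow> 'v) \<Rightarrow> bool" where
  "finite_path V E K p \<longleftrightarrow> (\<forall>k\<le>K. p k \<in> V) \<and> (\<forall>k<K. {p k, p (Suc k)} \<in> E)"

definition ray :: "'v set \<Rightarrow> 'v set set \<Rightarrow> (nat \<Rightarrow> 'v) \<Rightarrow> bool" where
  "ray V E p \<longleftrightarrow> (\<forall>k. p k \<in> V) \<and> (\<forall>k. {p k, p (Suc k)} \<in> E)"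

definition double_ray :: "'v set \<Rightarrow> 'v set set \<Rightarrow> (int \<Rightarrow> 'v) \<Rightarrow> bool" where
  "double_ray V E p \<longleftrightarrow> (\<forall>k. p k \<in> V) \<and> (\<forall>k. {p k, p (k + 1)} \<in> E)"

definition connected_graph :: "'v set \<Rightarrow> 'v set set \<Rightarrow> bool" where
  "connected_graph V E \<longleftrightarrow>
     (\<forall>u\<in>V. \<forall>v\<in>V. \<exists>K p. finite_path V E K p \<and> p 0 = u \<and> p K = v)"

definition path_length :: "('v \<Rightarrow> 'v \<Rightarrow> real) \<Rightarrow> nat \<Rightarrow> (nat \<Rightarrow> 'v) \<Rightarrow> real" where
  "path_length R K p = (\<Sum>k<K. R (p k) (p (Suc k)))"

definition path_dist :: "'v set \<Rightarrow> 'v set set \<Rightarrow> ('v \<Rightarrow> 'v \<Rightarrow> real) \<Rightarrow> 'v \<Rightarrow> 'v \<Rightarrow> real" where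
  "path_dist V E R u v =
     Inf {path_length R K p | K p. finite_path V E K p \<and> p 0 = u \<and> p K = v}"

text \<open>The metric completion is treated up to isometry: a complete set \<open>M\<close> in a metric space
  together with a dense isometric embedding \<open>\<iota>\<close> of the vertex set.
  Lemma \<open>graph_completion_exists\<close> below shows that every connected weighted graph has one.\<close>

definition graph_completion ::
    "'v set \<Rightarrow> 'v set set \<Rightarrow> ('v \<Rightarrow> 'v \<Rightarrow> real) \<Rightarrow> ('v \<Rightarrow> 'b::metric_space) \<Rightarrow> 'b set \<Rightarrow> bool" where
  "graph_completion V E R \<iota> M \<longleftrightarrow>
     complete M \<and> \<iota> ` V \<subseteq> M \<and> M \<subseteq> closure (\<iota> ` V) \<and>
     (\<forall>u\<in>V. \<forall>v\<in>V. dist (\<iota> u) (\<iota> v) = path_dist V E R u v)"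

text \<open>\<open>path_between V E \<iota> x y D\<close>: some path (finite, ray, or double ray) goes from the point \<open>x\<close>
  to the point \<open>y\<close> of the completion, and \<open>D\<close> is the set of edges it contains. Rays are indexed
  in the forward direction only; this loses nothing in \<open>weakly_connected\<close>, which ranges over both
  orders of the two points.\<close>

definition path_between ::
    "'v set \<Rightarrow> 'v set set \<Rightarrow> ('v \<Rightarrow> 'b::metric_space) \<Rightarrow> 'b \<Rightarrow> 'b \<Rightarrow> 'v set set \<Rightarrow> bool" where
  "path_between V E \<iota> x y D \<longleftrightarrow>
     (\<exists>K p. finite_path V E K p \<and> \<iota> (p 0) = x \<and> \<iota> (p K) = y \<and>
        D = {{p k, p (Suc k)} | k. k < K}) \<or>
     (\<exists>p. ray V E p \<and> \<iota> (p 0) = x \<and> ((\<lambda>k. \<iota> (p k)) \<longlongrightarrow> y) at_top \<and>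
        D = {{p k, p (Suc k)} | k. True}) \<or>
     (\<exists>p. double_ray V E p \<and> ((\<lambda>k. \<iota> (p k)) \<longlongrightarrow> x) at_bot \<and> ((\<lambda>k. \<iota> (p k)) \<longlongrightarrow> y) at_top \<and>
        D = {{p k, p (k + 1)} | k. True})"

definition weakly_connected ::
    "'v set \<Rightarrow> 'v set set \<Rightarrow> ('v \<Rightarrow> 'b::metric_space) \<Rightarrow> 'b set \<Rightarrow> bool" where
  "weakly_connected V E \<iota> M \<longleftrightarrow>
     (\<forall>x\<in>M. \<forall>y\<in>M. x \<noteq> y \<longrightarrow>
        (\<exists>W. finite W \<and> W \<subseteq> E \<and> (\<forall>D. path_between V E \<iota> x y D \<longrightarrow> D \<inter> W \<noteq> {})))"

definition interior_vertices :: "'v set \<Rightarrow> 'v set set \<Rightarrow> 'v set" where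
  "interior_vertices V E = {v \<in> V. 2 \<le> degree E v}"

text \<open>The boundary can be empty: in a finite graph all of whose vertices have degree at least 2 the
  harmonic functions are the constants, so unique solvability of the Dirichlet problem requires a
  nonempty boundary.\<close>

definition graph_boundary ::
    "'v set \<Rightarrow> 'v set set \<Rightarrow> ('v \<Rightarrow> 'b) \<Rightarrow> 'b set \<Rightarrow> 'b set" where
  "graph_boundary V E \<iota> M = M - \<iota> ` interior_vertices V E"

definition harmonic_on_graph ::
    "'v set \<Rightarrow> 'v set set \<Rightarrow> ('v \<Rightarrow> 'v \<Rightarrow> real) \<Rightarrow> ('v \<Rightarrow> real) \<Rightarrow> bool" where
  "harmonic_on_graph V E R f \<longleftrightarrow>
     (\<forall>v\<in>interior_vertices V E.
        f v = 1 / (\<Sum>u\<in>neighbours E v. conductance E R u v) *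
              (\<Sum>u\<in>neighbours E v. conductance E R u v * f u))"

lemma complete_bounded_sequences: "complete (UNIV :: (nat \<Rightarrow>\<^sub>C real) set)"
proof (rule completeI)
  fix f :: "nat \<Rightarrow> (nat \<Rightarrow>\<^sub>C real)"
  assume "Cauchy f"
  then obtain g where "uniform_limit UNIV f g sequentially"
    using uniformly_convergent_eq_cauchy[of "\<lambda>_. True" f]
    unfolding Cauchy_def uniform_limit_sequentially_iff
    by (metis dist_fun_lt_imp_dist_val_lt)
  from uniform_limit_bcontfunE[OF this sequentially_bot]
  show "\<exists>l\<in>UNIV. f \<longlonglongrightarrow> l" by (metis UNIV_I)
qed

context
  fixes V :: "'v set" and E R
  assumes G: "weighted_graph V E R" and conn: "connected_graph V E"
begin

lemma path_length_nonneg: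
  assumes "finite_path V E K p" shows "0 \<le> path_length R K p"
  unfolding path_length_def
  by (rule sum_nonneg) (use assms G in \<open>auto simp: finite_path_def weighted_graph_def less_imp_le\<close>)

lemma path_dist_le:
  assumes "finite_path V E K p" "p 0 = u" "p K = v"
  shows "path_dist V E R u v \<le> path_length R K p"
  unfolding path_dist_def
  by (rule cInf_lower) (use assms path_length_nonneg in \<open>auto intro!: bdd_belowI[of _ 0]\<close>)

lemma path_dist_greatest:
  assumes "u \<in> V" "v \<in> V"
    and "\<And>K p. finite_path V E K p \<Longrightarrow> p 0 = u \<Longrightarrow> p K = v \<Longrightarrow> c \<le> path_length R K p"
  shows "c \<le> path_dist V E R u v"
  unfolding path_dist_def
proof (rule cInf_greatest)
  obtain K p where "finite_path V E K p" "p 0 = u" "p K = v"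
    using conn assms(1,2) unfolding connected_graph_def by meson
  then show "{path_length R K p | K p. finite_path V E K p \<and> p 0 = u \<and> p K = v} \<noteq> {}"
    by blast
qed (use assms(3) in auto)

lemma path_dist_nonneg: "u \<in> V \<Longrightarrow> v \<in> V \<Longrightarrow> 0 \<le> path_dist V E R u v"
  by (intro path_dist_greatest path_length_nonneg)

lemma path_dist_refl: "u \<in> V \<Longrightarrow> path_dist V E R u u = 0"
  using path_dist_le[of 0 "\<lambda>_. u" u u] path_dist_nonneg[of u u]
  by (auto simp: finite_path_def path_length_def)

lemma path_dist_sym_le:
  assumes "u \<in> V" "v \<in> V"
  shows "path_dist V E R u v \<le> path_dist V E R v u"
proof (rule path_dist_greatest[OF assms(2,1)])
  fix K p assume p: "finite_path V E K p" "p 0 = v" "p K = u"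
  define q where "q k = p (K - k)" for k
  have edge: "{p (Suc (K - Suc k)), p (K - Suc k)} \<in> E" if "k < K" for k
    using p(1) that by (simp add: finite_path_def insert_commute)
  have Suc: "Suc (K - Suc k) = K - k" if "k < K" for k
    using that by simp
  have q: "finite_path V E K q"
    using p(1) edge by (auto simp: finite_path_def q_def Suc)
  have "path_length R K q = (\<Sum>k<K. R (p (Suc (K - Suc k))) (p (K - Suc k)))"
    by (simp add: path_length_def q_def Suc)
  also have "\<dots> = (\<Sum>k<K. R (p (K - Suc k)) (p (Suc (K - Suc k))))"
    by (rule sum.cong) (use G edge in \<open>auto simp: weighted_graph_def\<close>)
  also have "\<dots> = path_length R K p"
    unfolding path_length_def by (rule sum.nat_diff_reindex)
  finally show "path_dist V E R u v \<le> path_length R K p"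
    using path_dist_le[OF q, of u v] p by (simp add: q_def)
qed

lemma path_dist_sym:
  "u \<in> V \<Longrightarrow> v \<in> V \<Longrightarrow> path_dist V E R u v = path_dist V E R v u"
  by (intro antisym path_dist_sym_le)

lemma path_dist_triangle:
  assumes "u \<in> V" "v \<in> V" "w \<in> V"
  shows "path_dist V E R u w \<le> path_dist V E R u v + path_dist V E R v w"
proof -
  have *: "path_dist V E R u w \<le> path_length R K p + path_length R L q"
    if p: "finite_path V E K p" "p 0 = u" "p K = v"
      and q: "finite_path V E L q" "q 0 = v" "q L = w" for K p L q
  proof -
    define r where "r k = (if k \<le> K then p k else q (k - K))" for k
    have r1: "r k = p k" if "k \<le> K" for k
      using that by (simp add: r_def)
    have r2: "r (K + k) = q k" for k
      using p(3) q(2) by (simp add: r_def)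
    have "finite_path V E (K + L) r"
      unfolding finite_path_def
    proof (intro conjI allI impI)
      fix k assume "k \<le> K + L"
      then show "r k \<in> V"
        using p(1) q(1) by (auto simp: finite_path_def r_def)
    next
      fix k assume k: "k < K + L"
      show "{r k, r (Suc k)} \<in> E"
      proof (cases "k < K")
        case True
        then show ?thesis using p(1) by (simp add: finite_path_def r1)
      next
        case False
        then obtain j where "k = K + j" using le_Suc_ex not_less by blast
        then show ?thesis
          using q(1) k r2[of j] r2[of "Suc j"] by (simp add: finite_path_def)
      qed
    qed
    moreover have "path_length R (K + L) r = path_length R K p + path_length R L q"
    proof -
      have "path_length R (K + L) r = path_length R K r + (\<Sum>k<L. R (r (K + k)) (r (Suc (K + k))))"
        unfolding path_length_def by (induction L) auto
      also have "(\<Sum>k<L. R (r (K + k)) (r (Suc (K + k)))) = path_length R L q"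
        unfolding path_length_def using r2 by (metis add_Suc_right)
      also have "path_length R K r = path_length R K p"
        by (simp add: path_length_def r1)
      finally show ?thesis .
    qed
    ultimately show ?thesis
      using path_dist_le[of "K + L" r u w] p q r1[of 0] r2[of L] by simp
  qed
  have "path_dist V E R u w - path_dist V E R v w \<le> path_dist V E R u v"
  proof (rule path_dist_greatest)
    fix K p assume p: "finite_path V E K p" "p 0 = u" "p K = v"
    have "path_dist V E R u w - path_length R K p \<le> path_dist V E R v w"
      by (rule path_dist_greatest) (use assms *[OF p] in \<open>auto simp: algebra_simps\<close>)
    then show "path_dist V E R u w - path_dist V E R v w \<le> path_length R K p"
      by simp
  qed (use assms in auto)
  then show ?thesis by simp
qed

text \<open>Existence of a completion by the Frechet embedding into the bounded sequences.\<close>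

lemma graph_completion_exists:
  "\<exists>(\<iota> :: 'v \<Rightarrow> nat \<Rightarrow>\<^sub>C real) M. graph_completion V E R \<iota> M"
proof (cases "V = {}")
  case True
  then show ?thesis by (auto simp: graph_completion_def complete_def)
next
  case False
  then obtain a where a: "a \<in> V" by blast
  define e where "e = from_nat_into V"
  have e: "e n \<in> V" for n
    using False by (simp add: e_def from_nat_into)
  have e_surj: "\<exists>n. e n = v" if "v \<in> V" for v
    using from_nat_into_surj[of V v] G that by (auto simp: e_def weighted_graph_def)
  define g where "g v n = path_dist V E R v (e n) - path_dist V E R a (e n)" for v n
  have g_dist: "\<bar>g u n - g v n\<bar> \<le> path_dist V E R u v" if "u \<in> V" "v \<in> V" for u v n
    using path_dist_triangle[of u v "e n"] path_dist_triangle[of v u "e n"]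
      path_dist_sym[of u v] e that
    by (auto simp: g_def abs_le_iff)
  have g_a: "g a n = 0" for n
    by (simp add: g_def)
  have g_bcont: "g v \<in> bcontfun" if "v \<in> V" for v
  proof (rule bcontfun_normI)
    show "continuous_on UNIV (g v)" by simp
    show "norm (g v n) \<le> path_dist V E R v a" for n
      using g_dist[OF that a, of n] g_a[of n] by simp
  qed
  define \<iota> where "\<iota> v = Bcontfun (g v)" for v
  have app: "apply_bcontfun (\<iota> v) = g v" if "v \<in> V" for v
    using g_bcont[OF that] by (simp add: \<iota>_def Bcontfun_inverse)
  have "dist (\<iota> u) (\<iota> v) = path_dist V E R u v" if uv: "u \<in> V" "v \<in> V" for u v
  proof (rule antisym)
    show "dist (\<iota> u) (\<iota> v) \<le> path_dist V E R u v"
      by (rule dist_bound) (use g_dist[OF uv] app uv in \<open>simp add: dist_real_def\<close>)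
    obtain n where n: "e n = v" using e_surj uv by blast
    have "path_dist V E R u v = \<bar>g u n - g v n\<bar>"
      using uv n path_dist_nonneg[of u v] by (simp add: g_def path_dist_refl)
    also have "\<dots> \<le> dist (\<iota> u) (\<iota> v)"
      using dist_bounded[of "\<iota> u" n "\<iota> v"] app uv by (simp add: dist_real_def)
    finally show "path_dist V E R u v \<le> dist (\<iota> u) (\<iota> v)" .
  qed
  moreover have "complete (closure (\<iota> ` V))"
    using complete_bounded_sequences by (rule complete_closed_subset[OF closed_closure subset_UNIV])
  ultimately have "graph_completion V E R \<iota> (closure (\<iota> ` V))"
    unfolding graph_completion_def by (intro conjI ballI closure_subset order_refl) blast+
  then show ?thesis by blast
qed

end

end

theory Submission
  imports Defs
begin

text \<open>Uniqueness is the maximum principle: vertices are isolated points of the completion, so the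
  maximum of a harmonic function spreads from an interior vertex along edges to the whole dense
  vertex set.

  For existence, Cauchy--Schwarz along a path bounds \<open>(f x - f y)\<^sup>2\<close> by the energy of \<open>f\<close> times the
  distance of \<open>x\<close> and \<open>y\<close>. Hence functions of bounded energy with prescribed boundary values
  form a compact set for pointwise convergence, and an energy minimiser exists, is continuous and
  is harmonic. This solves the Dirichlet problem for boundary values of continuous functions that
  are constant across all but finitely many edges. By weak connectedness these functions separate
  points: deleting a finite edge set \<open>W\<close> that meets every path from \<open>x\<close> to \<open>y\<close> leaves components with
  positive mutual distance, and \<open>x\<close>, \<open>y\<close> cannot be limits of the same component, since otherwise
  short paths avoiding \<open>W\<close> could be concatenated to a path from \<open>x\<close> to \<open>y\<close>. By Stone--Weierstrass
  they approximate arbitrary boundary data uniformly, and by the maximum principle the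
  corresponding harmonic functions converge uniformly.\<close>

locale completed_graph =
  fixes V :: "'v set" and E :: "'v set set" and R :: "'v \<Rightarrow> 'v \<Rightarrow> real"
    and \<iota> :: "'v \<Rightarrow> 'b::metric_space" and M :: "'b set"
  assumes graph: "weighted_graph V E R"
    and conn: "connected_graph V E"
    and completion: "graph_completion V E R \<iota> M"
begin

section \<open>Short paths, and reachability after deleting edges\<close>

definition adjacent_off :: "'v set set \<Rightarrow> ('v \<times> 'v) set" where
  "adjacent_off W = {(u, v). {u, v} \<in> E - W}"

lemma edgeD:
  assumes "{u, v} \<in> E"
  shows "u \<in> V" "v \<in> V" "u \<noteq> v" "R u v = R v u" "0 < R u v"
proof -
  obtain a b where "a \<in> V" "b \<in> V" "a \<noteq> b" "{u, v} = {a, b}"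
    using graph assms unfolding weighted_graph_def by meson
  then show "u \<in> V" "v \<in> V" "u \<noteq> v" by (auto simp: doubleton_eq_iff)
  show "R u v = R v u" "0 < R u v"
    using graph assms unfolding weighted_graph_def by blast+
qed

lemma iota_in: "v \<in> V \<Longrightarrow> \<iota> v \<in> M"
  using completion by (auto simp: graph_completion_def)

lemma dist_iota: "u \<in> V \<Longrightarrow> v \<in> V \<Longrightarrow> dist (\<iota> u) (\<iota> v) = path_dist V E R u v"
  using completion by (auto simp: graph_completion_def)

lemma dense: "x \<in> M \<Longrightarrow> 0 < e \<Longrightarrow> \<exists>v\<in>V. dist (\<iota> v) x < e"
  using completion by (fastforce simp: graph_completion_def closure_approachable)

lemma obtain_path:
  assumes "u \<in> V" "v \<in> V" "dist (\<iota> u) (\<iota> v) < c"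
  obtains K p where "finite_path V E K p" "p 0 = u" "p K = v" "path_length R K p < c"
proof -
  have "\<not> c \<le> path_dist V E R u v"
    using assms by (simp add: dist_iota)
  then show thesis
    using path_dist_greatest[OF graph conn assms(1,2), of c] that not_le by metis
qed

lemma finite_pathD:
  assumes "finite_path V E K p" "k < K"
  shows "{p k, p (Suc k)} \<in> E" "0 < R (p k) (p (Suc k))"
  using assms edgeD(5) by (auto simp: finite_path_def)

lemma edge_le_path_length:
  assumes "finite_path V E K p" "k < K"
  shows "R (p k) (p (Suc k)) \<le> path_length R K p"
  unfolding path_length_def
  by (rule member_le_sum) (use finite_pathD[OF assms(1)] assms in \<open>auto intro: less_imp_le\<close>)

lemma dist_along_path:
  assumes p: "finite_path V E K p" and k: "k \<le> K"
  shows "dist (\<iota> (p 0)) (\<iota> (p k)) \<le> path_length R K p"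
proof -
  have "finite_path V E k p"
    using assms by (auto simp: finite_path_def)
  then have "dist (\<iota> (p 0)) (\<iota> (p k)) \<le> path_length R k p"
    using path_dist_le[OF graph conn, of k p] by (simp add: dist_iota finite_path_def)
  also have "\<dots> \<le> path_length R K p"
    unfolding path_length_def
    by (rule sum_mono2) (use finite_pathD[OF p] k in \<open>auto intro: less_imp_le\<close>)
  finally show ?thesis .
qed

lemma finite_arcs_of:
  assumes "finite W" "W \<subseteq> E"
  shows "finite {(u, v). {u, v} \<in> W}"
proof -
  have "finite (\<Union>W)"
    using assms graph by (force simp: weighted_graph_def)
  then show ?thesis
    by (rule_tac finite_subset[of _ "\<Union>W \<times> \<Union>W"]) auto
qed

text \<open>Finitely many positive resistances have a positive minimum \<delta>. It is the scale of
  everything below: a path shorter than \<delta> cannot use an edge of \<open>W\<close>.\<close>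

lemma edge_resistance_bound:
  assumes "finite W" "W \<subseteq> E"
  obtains \<delta> where "0 < \<delta>" "\<And>u v. {u, v} \<in> W \<Longrightarrow> \<delta> \<le> R u v"
proof -
  define P where "P = {(u, v). {u, v} \<in> W}"
  have "finite P"
    unfolding P_def by (rule finite_arcs_of[OF assms])
  \<comment> \<open>Inserting 1 keeps the minimum meaningful when \<open>W\<close> is empty.\<close>
  define \<delta> where "\<delta> = Min (insert 1 ((\<lambda>(u, v). R u v) ` P))"
  show thesis
  proof
    show "0 < \<delta>"
      using \<open>finite P\<close> edgeD(5) assms(2) by (auto simp: \<delta>_def P_def)
    show "\<delta> \<le> R u v" if "{u, v} \<in> W" for u v
      unfolding \<delta>_def by (rule Min_le) (use that \<open>finite P\<close> in \<open>force simp: P_def\<close>)+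
  qed
qed

lemma path_reachable_off:
  assumes "finite_path V E K p" "\<And>k. k < K \<Longrightarrow> {p k, p (Suc k)} \<notin> W" "k \<le> K"
  shows "(p 0, p k) \<in> (adjacent_off W)\<^sup>*"
  using assms(3)
proof (induction k)
  case (Suc k)
  then have "(p k, p (Suc k)) \<in> adjacent_off W"
    using assms finite_pathD(1) by (simp add: adjacent_off_def)
  then show ?case using Suc by (meson Suc_leD rtrancl.rtrancl_into_rtrancl)
qed simp

lemma short_path_avoids:
  assumes "finite_path V E K p" "path_length R K p < \<delta>"
    and "\<And>u v. {u, v} \<in> W \<Longrightarrow> \<delta> \<le> R u v" "k < K"
  shows "{p k, p (Suc k)} \<notin> W"
  using edge_le_path_length[of K p k] assms by fastforce

text \<open>The distance is an infimum of path lengths, so some joining path is itself shorter than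
  \<delta> and avoids \<open>W\<close>. Hence different components of the graph without
  \<open>W\<close> are at distance at least \<delta>.\<close>

lemma close_reachable_off:
  assumes "u \<in> V" "v \<in> V" "dist (\<iota> u) (\<iota> v) < \<delta>" "\<And>u v. {u, v} \<in> W \<Longrightarrow> \<delta> \<le> R u v"
  shows "(u, v) \<in> (adjacent_off W)\<^sup>*"
proof -
  obtain K p where p: "finite_path V E K p" "p 0 = u" "p K = v" "path_length R K p < \<delta>"
    using obtain_path[OF assms(1-3)] by blast
  show ?thesis
    using path_reachable_off[OF p(1), of W K] short_path_avoids[OF p(1,4) assms(4)] p(2,3)
    by auto
qed

lemma adjacent_off_sym: "(u, v) \<in> adjacent_off W \<Longrightarrow> (v, u) \<in> adjacent_off W"
  by (simp add: adjacent_off_def insert_commute)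

lemma reachable_off_sym: "(u, v) \<in> (adjacent_off W)\<^sup>* \<Longrightarrow> (v, u) \<in> (adjacent_off W)\<^sup>*"
  by (meson adjacent_off_sym sym_def sym_rtrancl)

lemma reachable_off_in: "(u, v) \<in> (adjacent_off W)\<^sup>* \<Longrightarrow> u \<in> V \<Longrightarrow> v \<in> V"
  by (induction rule: rtrancl_induct) (auto simp: adjacent_off_def dest: edgeD)

text \<open>Deleting the edges at \<open>v\<close> makes \<open>{v}\<close> a component.\<close>

lemma vertex_isolated:
  assumes v: "v \<in> V"
  obtains \<delta> where "0 < \<delta>" "\<And>x. x \<in> M \<Longrightarrow> dist (\<iota> v) x < \<delta> \<Longrightarrow> x = \<iota> v"
    "\<And>w. w \<in> V \<Longrightarrow> dist (\<iota> v) (\<iota> w) < \<delta> \<Longrightarrow> w = v"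
proof -
  define W where "W = {e \<in> E. v \<in> e}"
  have "finite W" "W \<subseteq> E"
    using graph v by (auto simp: W_def weighted_graph_def)
  then obtain \<delta> where \<delta>: "0 < \<delta>" "\<And>u v. {u, v} \<in> W \<Longrightarrow> \<delta> \<le> R u v"
    using edge_resistance_bound by blast
  have eq: "w = v" if w: "w \<in> V" "dist (\<iota> v) (\<iota> w) < \<delta>" for w
  proof -
    have "(v, w) \<in> (adjacent_off W)\<^sup>*"
      using close_reachable_off[OF v w \<delta>(2)] by blast
    \<comment> \<open>A first step away from \<open>v\<close> would use an edge incident to
      \<open>v\<close>, and all of these lie in \<open>W\<close>.\<close>
    then show ?thesis
      by (rule converse_rtranclE) (auto simp: adjacent_off_def W_def)
  qed
  show thesis
  proof
    fix x assume x: "x \<in> M" "dist (\<iota> v) x < \<delta>"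
    \<comment> \<open>Vertices close enough to \<open>x\<close> are still within \<delta> of
      \<open>v\<close>, so they equal \<open>v\<close>; thus \<open>v\<close> itself is arbitrarily
      close to \<open>x\<close>.\<close>
    have "dist (\<iota> v) x \<le> e" if e: "e > 0" for e
    proof -
      obtain w where w: "w \<in> V" "dist (\<iota> w) x < min e (\<delta> - dist (\<iota> v) x)"
        using dense[OF x(1), of "min e (\<delta> - dist (\<iota> v) x)"] x e
        by (metis diff_gt_0_iff_gt min_less_iff_conj)
      then have "dist (\<iota> v) (\<iota> w) < \<delta>"
        using dist_triangle[of "\<iota> v" "\<iota> w" x] by (simp add: dist_commute)
      then show ?thesis using eq[OF w(1)] w(2) by simp
    qed
    then have "dist (\<iota> v) x \<le> 0" by (meson field_le_epsilon add_0 linorder_not_le dense_ge)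
    then show "x = \<iota> v" by simp
  qed (use \<delta> eq in auto)
qed

lemma inj_iota: "inj_on \<iota> V"
proof (rule inj_onI)
  fix u v assume "u \<in> V" "v \<in> V" "\<iota> u = \<iota> v"
  then show "u = v" using vertex_isolated[of u] by (metis dist_self)
qed

subsection \<open>Boundary and maximum principle\<close>

abbreviation (input) "B \<equiv> graph_boundary V E \<iota> M"

lemma boundary_cases:
  assumes "x \<in> M" "x \<notin> B"
  obtains v where "v \<in> interior_vertices V E" "x = \<iota> v"
  using assms by (auto simp: graph_boundary_def)

lemma interior_vertices_subset: "interior_vertices V E \<subseteq> V"
  by (auto simp: interior_vertices_def)

text \<open>Interior vertices are isolated, so each has a ball meeting \<open>M\<close> only in its
  centre. Removing these open balls from \<open>M\<close> leaves exactly the boundary.\<close>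

lemma compact_boundary:
  assumes "compact M" shows "compact B"
proof -
  have "\<exists>\<delta>>0. \<forall>x\<in>M. dist (\<iota> v) x < \<delta> \<longrightarrow> x = \<iota> v" if "v \<in> interior_vertices V E" for v
    by (rule vertex_isolated[of v]) (use that interior_vertices_subset in auto)
  then obtain \<delta> where \<delta>: "\<And>v. v \<in> interior_vertices V E \<Longrightarrow> 0 < \<delta> v"
      "\<And>v x. v \<in> interior_vertices V E \<Longrightarrow> x \<in> M \<Longrightarrow> dist (\<iota> v) x < \<delta> v \<Longrightarrow> x = \<iota> v"
    by metis
  have "B = M - (\<Union>v\<in>interior_vertices V E. ball (\<iota> v) (\<delta> v))"
  proof (intro set_eqI iffI)
    fix x assume "x \<in> B"
    then show "x \<in> M - (\<Union>v\<in>interior_vertices V E. ball (\<iota> v) (\<delta> v))"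
      using \<delta>(2) by (force simp: graph_boundary_def)
  next
    fix x assume "x \<in> M - (\<Union>v\<in>interior_vertices V E. ball (\<iota> v) (\<delta> v))"
    then show "x \<in> B"
      using \<delta>(1) by (force simp: graph_boundary_def)
  qed
  then show ?thesis
    using compact_diff[OF assms] by (simp add: open_UN)
qed

lemma finite_neighbours:
  assumes "v \<in> V" shows "finite (neighbours E v)" "neighbours E v \<noteq> {}"
proof -
  have inc: "finite {e \<in> E. v \<in> e}" "{e \<in> E. v \<in> e} \<noteq> {}"
    using graph assms by (auto simp: weighted_graph_def)
  have "inj_on (\<lambda>u. {u, v}) (neighbours E v)"
    by (auto simp: inj_on_def doubleton_eq_iff)
  moreover have "(\<lambda>u. {u, v}) ` neighbours E v \<subseteq> {e \<in> E. v \<in> e}"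
    by (auto simp: neighbours_def)
  ultimately show "finite (neighbours E v)"
    using inc(1) inj_on_finite by blast
  obtain e where "e \<in> E" "v \<in> e" using inc(2) by blast
  moreover then obtain a b where "e = {a, b}"
    using graph unfolding weighted_graph_def by meson
  ultimately have "a \<in> neighbours E v \<or> b \<in> neighbours E v"
    by (auto simp: neighbours_def insert_commute)
  then show "neighbours E v \<noteq> {}" by blast
qed

lemma conductance_pos: "u \<in> neighbours E v \<Longrightarrow> 0 < conductance E R u v"
  using edgeD by (auto simp: conductance_def neighbours_def)

text \<open>Clearing the positive denominator gives Kirchhoff's current law. This form is linear in
  \<open>f\<close>, passes to limits, and is the first variation of the energy.\<close>

lemma harmonic_iff:
  "harmonic_on_graph V E R f \<longleftrightarrow>
     (\<forall>v\<in>interior_vertices V E. (\<Sum>u\<in>neighbours E v. conductance E R u v * (f u - f v)) = 0)"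
proof -
  have "f v = 1 / (\<Sum>u\<in>neighbours E v. conductance E R u v) *
              (\<Sum>u\<in>neighbours E v. conductance E R u v * f u) \<longleftrightarrow>
        (\<Sum>u\<in>neighbours E v. conductance E R u v * (f u - f v)) = 0"
    if "v \<in> interior_vertices V E" for v
  proof -
    have "v \<in> V" using that interior_vertices_subset by blast
    then have "0 < (\<Sum>u\<in>neighbours E v. conductance E R u v)"
      by (intro sum_pos finite_neighbours conductance_pos)
    moreover have "(\<Sum>u\<in>neighbours E v. conductance E R u v * (f u - f v)) =
        (\<Sum>u\<in>neighbours E v. conductance E R u v * f u) -
        (\<Sum>u\<in>neighbours E v. conductance E R u v) * f v"
      by (simp add: right_diff_distrib sum_subtractf sum_distrib_right)
    ultimately show ?thesis
      by (auto simp: nonzero_eq_divide_eq mult.commute)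
  qed
  then show ?thesis by (simp add: harmonic_on_graph_def)
qed

text \<open>If the maximum \<open>m\<close> exceeded \<open>c\<close>, it would be attained only off
  the boundary. It then spreads to all vertices, and density forces it on a boundary point, which
  exists as \<open>B\<close> is nonempty.\<close>

lemma maximum_principle:
  assumes M: "compact M" and B: "B \<noteq> {}"
    and f: "continuous_on M f" and harm: "harmonic_on_graph V E R (\<lambda>v. f (\<iota> v))"
    and le: "\<And>x. x \<in> B \<Longrightarrow> f x \<le> c" and x: "x \<in> M"
  shows "f x \<le> c"
proof (rule ccontr)
  assume "\<not> f x \<le> c"
  obtain x0 where x0: "x0 \<in> M" "\<And>y. y \<in> M \<Longrightarrow> f y \<le> f x0"
    using continuous_attains_sup[OF M _ f] x by blast
  define m where "m = f x0"
  have "c < m" using x0(2)[OF x] \<open>\<not> f x \<le> c\<close> by (simp add: m_def)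
  have int: "v \<in> interior_vertices V E" if v: "v \<in> V" "f (\<iota> v) = m" for v
  proof -
    have "\<iota> v \<notin> B" using le v \<open>c < m\<close> by force
    then obtain w where w: "w \<in> interior_vertices V E" "\<iota> v = \<iota> w"
      using boundary_cases[OF iota_in[OF v(1)]] by blast
    then have "v = w"
      using inj_onD[OF inj_iota, of v w] v interior_vertices_subset by blast
    then show ?thesis using w by simp
  qed
  have step: "f (\<iota> u) = m" if v: "v \<in> V" "f (\<iota> v) = m" and u: "{u, v} \<in> E" for u v
  proof -
    \<comment> \<open>At a maximum the balance is a vanishing sum of nonnegative terms, so every
      term vanishes.\<close>
    have "(\<Sum>u\<in>neighbours E v. conductance E R u v * (m - f (\<iota> u))) = 0"
      using harm int[OF v] v(2)
      by (auto simp: harmonic_iff right_diff_distrib sum_subtractf)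
    moreover have "0 \<le> conductance E R w v * (m - f (\<iota> w))" if "w \<in> neighbours E v" for w
      using conductance_pos[OF that] x0(2) iota_in edgeD(1)[of w v] that
      by (simp add: m_def neighbours_def)
    ultimately have "conductance E R u v * (m - f (\<iota> u)) = 0"
      using sum_nonneg_eq_0_iff[OF finite_neighbours(1)[OF v(1)],
          of "\<lambda>u. conductance E R u v * (m - f (\<iota> u))"] u
      unfolding neighbours_def by blast
    then show ?thesis
      using conductance_pos[of u v] u by (simp add: neighbours_def)
  qed
  have "x0 \<notin> B" using le \<open>c < m\<close> by (force simp: m_def)
  then obtain v0 where v0: "v0 \<in> V" "f (\<iota> v0) = m"
    using boundary_cases[OF x0(1)] interior_vertices_subset m_def by blast
  have all: "f (\<iota> v) = m" if v: "v \<in> V" for v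
  proof -
    obtain K p where p: "finite_path V E K p" "p 0 = v0" "p K = v"
      using conn v0(1) v unfolding connected_graph_def by meson
    have "f (\<iota> (p k)) = m" if "k \<le> K" for k
      using that
    proof (induction k)
      case (Suc k)
      then have "{p (Suc k), p k} \<in> E" "p k \<in> V"
        using finite_pathD(1)[OF p(1), of k] p(1) by (auto simp: insert_commute finite_path_def)
      then show ?case using step[of "p k" "p (Suc k)"] Suc by simp
    qed (use p v0 in simp)
    then show ?thesis using p(3) by blast
  qed
  obtain b where b: "b \<in> B" "b \<in> M" using B by (auto simp: graph_boundary_def)
  \<comment> \<open>By continuity \<open>f\<close> stays below \<open>m\<close> near
    \<open>b\<close>, yet vertices of value \<open>m\<close> accumulate there.\<close>
  have "f b < m" using le[OF b(1)] \<open>c < m\<close> by simp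
  then obtain d where d: "0 < d" "\<And>y. y \<in> M \<Longrightarrow> dist y b < d \<Longrightarrow> dist (f y) (f b) < m - f b"
    using f b(2) unfolding continuous_on_iff by (meson diff_gt_0_iff_gt)
  obtain v where "v \<in> V" "dist (\<iota> v) b < d" using dense[OF b(2) d(1)] by blast
  then show False using d(2)[of "\<iota> v"] all iota_in by (force simp: dist_real_def)
qed

lemma harmonic_difference:
  assumes "harmonic_on_graph V E R f" "harmonic_on_graph V E R g"
  shows "harmonic_on_graph V E R (\<lambda>v. f v - g v)"
proof -
  have "(\<Sum>u\<in>N. c u * (f u - g u - (f v - g v))) =
      (\<Sum>u\<in>N. c u * (f u - f v)) - (\<Sum>u\<in>N. c u * (g u - g v))" for c :: "'v \<Rightarrow> real" and N v
    by (simp add: sum_subtractf[symmetric] algebra_simps)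
  then show ?thesis using assms by (simp add: harmonic_iff)
qed

text \<open>The maximum principle for both differences. With \<open>c = 0\<close> it yields
  uniqueness; with small \<open>c\<close> it turns uniform convergence on the boundary into uniform
  convergence on \<open>M\<close>.\<close>

lemma harmonic_difference_bound:
  assumes M: "compact M" and B: "B \<noteq> {}"
    and f: "continuous_on M f" "harmonic_on_graph V E R (\<lambda>v. f (\<iota> v))"
    and g: "continuous_on M g" "harmonic_on_graph V E R (\<lambda>v. g (\<iota> v))"
    and le: "\<And>x. x \<in> B \<Longrightarrow> \<bar>f x - g x\<bar> \<le> c" and x: "x \<in> M"
  shows "\<bar>f x - g x\<bar> \<le> c"
proof -
  have "f x - g x \<le> c"
    by (rule maximum_principle[OF M B, of "\<lambda>x. f x - g x"])
      (use f g le x in \<open>auto intro: continuous_on_diff harmonic_difference simp: abs_le_iff\<close>)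
  moreover have "g x - f x \<le> c"
    by (rule maximum_principle[OF M B, of "\<lambda>x. g x - f x"])
      (use f g le x in \<open>auto intro: continuous_on_diff harmonic_difference simp: abs_le_iff\<close>)
  ultimately show ?thesis by simp
qed

subsection \<open>Energy\<close>

text \<open>Edges as ordered pairs: every edge occurs in both directions, so the energy over all
  arcs is twice the usual Dirichlet energy.\<close>

definition arcs :: "('v \<times> 'v) set" where
  "arcs = {(u, v). {u, v} \<in> E}"

definition energy_on :: "('v \<times> 'v) set \<Rightarrow> ('b \<Rightarrow> real) \<Rightarrow> real" where
  "energy_on S f = (\<Sum>(u, v)\<in>S. (f (\<iota> u) - f (\<iota> v))\<^sup>2 / R u v)"

text \<open>Bounding all finite partial sums avoids infinite sums and expresses an energy bound by
  conditions that are closed under pointwise convergence.\<close>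

definition energy_le :: "('b \<Rightarrow> real) \<Rightarrow> real \<Rightarrow> bool" where
  "energy_le f c \<longleftrightarrow> (\<forall>S. finite S \<longrightarrow> S \<subseteq> arcs \<longrightarrow> energy_on S f \<le> c)"

lemma energy_term_nonneg: "(u, v) \<in> arcs \<Longrightarrow> 0 \<le> (f (\<iota> u) - f (\<iota> v))\<^sup>2 / R u v"
  using edgeD(5) by (auto simp: arcs_def intro!: divide_nonneg_pos)

lemma energy_on_mono:
  assumes "finite T" "S \<subseteq> T" "T \<subseteq> arcs"
  shows "energy_on S f \<le> energy_on T f"
  unfolding energy_on_def
proof (rule sum_mono2)
  fix a assume "a \<in> T - S"
  then have "(fst a, snd a) \<in> arcs" using assms by auto
  then show "0 \<le> (case a of (u, v) \<Rightarrow> (f (\<iota> u) - f (\<iota> v))\<^sup>2 / R u v)"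
    by (simp only: case_prod_unfold energy_term_nonneg)
qed (use assms in auto)

lemma energy_le_nonneg: "energy_le f c \<Longrightarrow> 0 \<le> c"
  unfolding energy_le_def energy_on_def by (drule spec[of _ "{}"]) simp

lemma energy_le_mono: "energy_le f c \<Longrightarrow> c \<le> c' \<Longrightarrow> energy_le f c'"
  unfolding energy_le_def by (meson order_trans)

text \<open>The stretch between two visits to the same vertex can be cut out; this saves edges and
  adds no length.\<close>

lemma shortcut_path:
  assumes p: "finite_path V E K p" and ij: "i < j" "j \<le> K" "p i = p j"
  obtains q where "finite_path V E (K - (j - i)) q" "q 0 = p 0" "q (K - (j - i)) = p K"
    "path_length R (K - (j - i)) q \<le> path_length R K p"
proof
  \<comment> \<open>\<sigma> skips the indices from \<open>i\<close> to \<open>j - 1\<close>. The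
    jump from \<open>i - 1\<close> to \<open>j\<close> is still an edge because
    \<open>p i = p j\<close>.\<close>
  define \<sigma> where "\<sigma> k = (if k < i then k else k + (j - i))" for k
  define q where "q k = p (\<sigma> k)" for k
  let ?L = "K - (j - i)"
  have step: "q (Suc k) = p (Suc (\<sigma> k))" for k
  proof (cases "Suc k = i")
    case True
    then have "\<sigma> (Suc k) = j" using ij by (simp add: \<sigma>_def)
    moreover have "\<sigma> k = k" using True by (simp add: \<sigma>_def)
    ultimately show ?thesis using True ij by (simp add: q_def)
  qed (auto simp: q_def \<sigma>_def)
  have less: "\<sigma> k < K" if "k < ?L" for k
    using that ij by (auto simp: \<sigma>_def)
  have "\<sigma> k \<le> K" if "k \<le> ?L" for k
    using that ij by (auto simp: \<sigma>_def)
  then show "finite_path V E ?L q"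
    using p less by (auto simp: finite_path_def step) (simp add: q_def)+
  show "q 0 = p 0" "q ?L = p K"
    using ij by (auto simp: q_def \<sigma>_def)
  have "path_length R ?L q = (\<Sum>k<?L. R (p (\<sigma> k)) (p (Suc (\<sigma> k))))"
    by (simp add: path_length_def step) (simp add: q_def)
  also have "\<dots> = (\<Sum>k\<in>\<sigma> ` {..<?L}. R (p k) (p (Suc k)))"
    by (rule sum.reindex[unfolded comp_def, symmetric]) (auto simp: inj_on_def \<sigma>_def split: if_splits)
  also have "\<dots> \<le> path_length R K p"
    unfolding path_length_def
    by (rule sum_mono2) (use less finite_pathD(2)[OF p] in \<open>auto intro: less_imp_le\<close>)
  finally show "path_length R ?L q \<le> path_length R K p" .
qed

text \<open>Among the paths shorter than \<open>c\<close>, one with the fewest edges repeats no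
  vertex, since a repetition would allow a shortcut.\<close>

lemma obtain_injective_path:
  assumes "u \<in> V" "v \<in> V" "dist (\<iota> u) (\<iota> v) < c"
  obtains K p where "finite_path V E K p" "p 0 = u" "p K = v" "path_length R K p < c"
    "inj_on p {..K}"
proof -
  define P where
    "P K p \<longleftrightarrow> finite_path V E K p \<and> p 0 = u \<and> p K = v \<and> path_length R K p < c" for K p
  define K where "K = (LEAST K. \<exists>p. P K p)"
  have "\<exists>K p. P K p"
    using obtain_path[OF assms] unfolding P_def by metis
  then have "\<exists>p. P K p"
    unfolding K_def by (rule LeastI_ex)
  then obtain p where p: "P K p" by blast
  have "p i \<noteq> p j" if ij: "i < j" "j \<le> K" for i j
  proof
    assume "p i = p j"
    then obtain q where "P (K - (j - i)) q"
      using shortcut_path[of K p i j] ij p unfolding P_def by (metis order_le_less_trans)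
    then have "K \<le> K - (j - i)"
      unfolding K_def by (metis (mono_tags, lifting) Least_le)
    then show False using ij by simp
  qed
  then have "inj_on p {..K}"
    by (auto intro!: linorder_inj_onI)
  then show thesis using that p unfolding P_def by blast
qed

text \<open>Cauchy--Schwarz along a path without repeated vertices, so that no edge is counted twice.\<close>

lemma injective_path_energy:
  assumes f: "energy_le f c" and p: "finite_path V E K p" and inj: "inj_on p {..K}"
  shows "(f (\<iota> (p 0)) - f (\<iota> (p K)))\<^sup>2 \<le> c * path_length R K p"
proof -
  let ?R = "\<lambda>k. R (p k) (p (Suc k))"
  let ?d = "\<lambda>k. f (\<iota> (p k)) - f (\<iota> (p (Suc k)))"
  let ?S = "(\<lambda>k. (p k, p (Suc k))) ` {..<K}"
  have pos: "0 < ?R k" if "k < K" for k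
    using finite_pathD(2)[OF p that] .
  have "inj_on (\<lambda>k. (p k, p (Suc k))) {..<K}"
    using inj by (auto simp: inj_on_def)
  then have "energy_on ?S f = (\<Sum>k<K. (?d k)\<^sup>2 / ?R k)"
    unfolding energy_on_def by (simp add: sum.reindex)
  moreover have "?S \<subseteq> arcs"
    using finite_pathD(1)[OF p] by (auto simp: arcs_def)
  ultimately have en: "(\<Sum>k<K. (?d k)\<^sup>2 / ?R k) \<le> c"
    using f unfolding energy_le_def by (metis finite_imageI finite_lessThan)
  have "f (\<iota> (p 0)) - f (\<iota> (p K)) = (\<Sum>k<K. ?d k)"
    using sum_lessThan_telescope'[of "\<lambda>k. f (\<iota> (p k))" K] by simp
  \<comment> \<open>This factorisation makes one Cauchy--Schwarz factor the length of the path and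
    the other its energy.\<close>
  also have "\<dots> = (\<Sum>k<K. sqrt (?R k) * (?d k / sqrt (?R k)))"
    by (rule sum.cong) (use pos in force)+
  finally have "(f (\<iota> (p 0)) - f (\<iota> (p K)))\<^sup>2 \<le>
      (\<Sum>k<K. (sqrt (?R k))\<^sup>2) * (\<Sum>k<K. (?d k / sqrt (?R k))\<^sup>2)"
    using Cauchy_Schwarz_ineq_sum[of "\<lambda>k. sqrt (?R k)" "\<lambda>k. ?d k / sqrt (?R k)" "{..<K}"]
    by simp
  also have "(\<Sum>k<K. (sqrt (?R k))\<^sup>2) = path_length R K p"
    unfolding path_length_def by (rule sum.cong) (use pos in \<open>auto simp: less_imp_le\<close>)
  also have "(\<Sum>k<K. (?d k / sqrt (?R k))\<^sup>2) = (\<Sum>k<K. (?d k)\<^sup>2 / ?R k)"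
    by (rule sum.cong) (use pos in \<open>auto simp: power_divide less_imp_le\<close>)
  also have "path_length R K p * \<dots> \<le> path_length R K p * c"
    by (rule mult_left_mono[OF en path_length_nonneg[OF graph conn p]])
  finally show ?thesis by (simp add: mult.commute)
qed

lemma energy_hoelder_vertices:
  assumes f: "energy_le f c" and uv: "u \<in> V" "v \<in> V"
  shows "(f (\<iota> u) - f (\<iota> v))\<^sup>2 \<le> c * dist (\<iota> u) (\<iota> v)"
proof -
  let ?D = "dist (\<iota> u) (\<iota> v)"
  have c: "0 \<le> c" using energy_le_nonneg[OF f] .
  have "(f (\<iota> u) - f (\<iota> v))\<^sup>2 \<le> c * ?D + e" if e: "0 < e" for e
  proof -
    \<comment> \<open>The slack costs at most \<open>e\<close> after multiplication by
      \<open>c\<close>; the denominator \<open>c + 1\<close> covers \<open>c = 0\<close>.\<close>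
    have "?D < ?D + e / (c + 1)" using e c by simp
    then obtain K p where p: "finite_path V E K p" "p 0 = u" "p K = v"
      "path_length R K p < ?D + e / (c + 1)" "inj_on p {..K}"
      using obtain_injective_path[OF uv] by blast
    have "(f (\<iota> u) - f (\<iota> v))\<^sup>2 \<le> c * path_length R K p"
      using injective_path_energy[OF f p(1,5)] p by simp
    also have "\<dots> \<le> c * (?D + e / (c + 1))"
      using p(4) c by (intro mult_left_mono) auto
    also have "\<dots> = c * ?D + e * (c / (c + 1))"
      by (simp add: algebra_simps)
    also have "e * (c / (c + 1)) \<le> e"
      using e c by (simp add: field_simps)
    finally show ?thesis by simp
  qed
  then show ?thesis by (rule field_le_epsilon)
qed

lemma vertex_sequence:
  assumes "x \<in> M"
  obtains s where "\<And>n. s n \<in> V" "(\<lambda>n. \<iota> (s n)) \<longlonglongrightarrow> x"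
proof -
  have "\<exists>v. v \<in> V \<and> dist (\<iota> v) x < inverse (real (Suc n))" for n
    using dense[OF assms, of "inverse (real (Suc n))"] by auto
  then obtain s where s: "\<And>n. s n \<in> V" "\<And>n. dist (\<iota> (s n)) x < inverse (real (Suc n))"
    by metis
  have "(\<lambda>n. dist (\<iota> (s n)) x) \<longlonglongrightarrow> 0"
    by (rule tendsto_sandwich[OF _ _ tendsto_const LIMSEQ_inverse_real_of_nat])
      (use less_imp_le[OF s(2)] in auto)
  then show thesis using that s(1) tendsto_dist_iff by blast
qed

text \<open>Vertices are dense and both sides are continuous, so the estimate extends to
  \<open>M\<close>. The constant depends on the energy bound alone.\<close>

lemma energy_hoelder:
  assumes f: "energy_le f c" "continuous_on M f" and xy: "x \<in> M" "y \<in> M"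
  shows "(f x - f y)\<^sup>2 \<le> c * dist x y"
proof -
  obtain s where s: "\<And>n. s n \<in> V" "(\<lambda>n. \<iota> (s n)) \<longlonglongrightarrow> x" using vertex_sequence[OF xy(1)] by blast
  obtain t where t: "\<And>n. t n \<in> V" "(\<lambda>n. \<iota> (t n)) \<longlonglongrightarrow> y" using vertex_sequence[OF xy(2)] by blast
  have lim: "(\<lambda>n. f (\<iota> (s n))) \<longlonglongrightarrow> f x" "(\<lambda>n. f (\<iota> (t n))) \<longlonglongrightarrow> f y"
    by (rule continuous_on_tendsto_compose[OF f(2)]; use s t xy iota_in in simp)+
  show ?thesis
  proof (rule LIMSEQ_le)
    show "(\<lambda>n. (f (\<iota> (s n)) - f (\<iota> (t n)))\<^sup>2) \<longlonglongrightarrow> (f x - f y)\<^sup>2"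
      by (intro tendsto_intros lim)
    show "(\<lambda>n. c * dist (\<iota> (s n)) (\<iota> (t n))) \<longlonglongrightarrow> c * dist x y"
      by (intro tendsto_intros s t)
    show "\<exists>N. \<forall>n\<ge>N. (f (\<iota> (s n)) - f (\<iota> (t n)))\<^sup>2 \<le> c * dist (\<iota> (s n)) (\<iota> (t n))"
      using energy_hoelder_vertices[OF f(1)] s t by blast
  qed
qed

section \<open>Hoelder bounds and compactness for pointwise convergence\<close>

lemma hoelder_continuous:
  fixes f :: "'b \<Rightarrow> real"
  assumes c: "0 \<le> c" and f: "\<And>x y. x \<in> M \<Longrightarrow> y \<in> M \<Longrightarrow> (f x - f y)\<^sup>2 \<le> c * dist x y"
  shows "continuous_on M f"
  unfolding continuous_on_iff
proof (intro ballI allI impI)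
  fix x e assume x: "x \<in> M" and e: "0 < (e::real)"
  show "\<exists>d>0. \<forall>x'\<in>M. dist x' x < d \<longrightarrow> dist (f x') (f x) < e"
  proof (intro exI conjI ballI impI)
    show "0 < e\<^sup>2 / (c + 1)" using e c by simp
    fix y assume y: "y \<in> M" "dist y x < e\<^sup>2 / (c + 1)"
    have "(f y - f x)\<^sup>2 \<le> c * dist y x" using f[OF y(1) x] .
    also have "\<dots> \<le> (c + 1) * dist y x" by (simp add: algebra_simps)
    also have "\<dots> < e\<^sup>2" using y(2) c by (simp add: field_simps)
    finally show "dist (f y) (f x) < e"
      using e power_less_imp_less_base[of "\<bar>f y - f x\<bar>" 2 e] by (simp add: dist_real_def)
  qed
qed

text \<open>Energy sees only vertices and continuity may be lost in pointwise limits, so the Hoelder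
  estimate is imposed separately, with a constant \<open>c0\<close> that stays fixed while the
  energy level \<open>c\<close> varies. Values outside \<open>M\<close> are prescribed too, because
  compactness is needed in the space of all functions on the type.\<close>

definition admissible :: "('b \<Rightarrow> real) \<Rightarrow> real \<Rightarrow> real \<Rightarrow> ('b \<Rightarrow> real) set" where
  "admissible g c0 c = {f. (\<forall>x. x \<notin> \<iota> ` interior_vertices V E \<longrightarrow> f x = g x) \<and>
     (\<forall>x\<in>M. \<forall>y\<in>M. (f x - f y)\<^sup>2 \<le> c0 * dist x y) \<and> energy_le f c}"

text \<open>Each defining condition involves finitely many values of \<open>f\<close>, and point
  evaluations are continuous in the product topology.\<close>

lemma closed_admissible: "closed (admissible g c0 c)"
proof -
  have "admissible g c0 c =
      (\<Inter>x\<in>- \<iota> ` interior_vertices V E. {f. f x = g x}) \<inter>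
      (\<Inter>x\<in>M. \<Inter>y\<in>M. {f. (f x - f y)\<^sup>2 \<le> c0 * dist x y}) \<inter>
      (\<Inter>S\<in>{S. finite S \<and> S \<subseteq> arcs}. {f. energy_on S f \<le> c})"
    by (auto simp: admissible_def energy_le_def)
  moreover have "closed {f :: 'b \<Rightarrow> real. f x = g x}" for x
    by (intro closed_Collect_eq continuous_intros) simp
  moreover have "closed {f :: 'b \<Rightarrow> real. (f x - f y)\<^sup>2 \<le> c0 * dist x y}" for x y
    by (intro closed_Collect_le continuous_intros) simp_all
  moreover have "closed {f. energy_on S f \<le> c}" for S
    unfolding energy_on_def case_prod_unfold divide_inverse
    by (intro closed_Collect_le continuous_intros) simp_all
  ultimately show ?thesis
    by (auto intro!: closed_Int closed_INT)
qed

text \<open>Tychonoff's theorem for a product of compact intervals.\<close>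

lemma compact_box:
  fixes l u :: "'c \<Rightarrow> real"
  shows "compact {f. \<forall>x. l x \<le> f x \<and> f x \<le> u x}"
proof -
  have "compactin (product_topology (\<lambda>_. euclidean) UNIV) (PiE UNIV (\<lambda>x. {l x..u x}))"
    by (simp add: compactin_PiE compactin_euclidean_iff)
  moreover have "PiE UNIV (\<lambda>x. {l x..u x}) = {f. \<forall>x. l x \<le> f x \<and> f x \<le> u x}"
    by (auto simp: PiE_def)
  ultimately show ?thesis
    by (simp add: euclidean_product_topology compactin_euclidean_iff)
qed

text \<open>The value at the boundary point \<open>b\<close> is prescribed, so the Hoelder estimate
  from \<open>b\<close> confines each value on \<open>M\<close> to a compact interval; off
  \<open>M\<close> the interval is a single point.\<close>

lemma compact_admissible:
  assumes b: "b \<in> B"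
  shows "compact (admissible g c0 c)"
proof -
  define l where "l x = (if x \<in> M then g b - sqrt (c0 * dist x b) else g x)" for x
  define u where "u x = (if x \<in> M then g b + sqrt (c0 * dist x b) else g x)" for x
  have b': "b \<in> M" "b \<notin> \<iota> ` interior_vertices V E" using b by (auto simp: graph_boundary_def)
  have "admissible g c0 c \<subseteq> {f. \<forall>x. l x \<le> f x \<and> f x \<le> u x}"
  proof (intro subsetI CollectI allI)
    fix f x assume f: "f \<in> admissible g c0 c"
    show "l x \<le> f x \<and> f x \<le> u x"
    proof (cases "x \<in> M")
      case True
      have "f b = g b" using f b' by (simp add: admissible_def)
      moreover have "(f x - f b)\<^sup>2 \<le> c0 * dist x b"
        using f True b'(1) unfolding admissible_def by blast
      ultimately have "(f x - g b)\<^sup>2 \<le> c0 * dist x b"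
        by simp
      then have "\<bar>f x - g b\<bar> \<le> sqrt (c0 * dist x b)"
        by (metis real_sqrt_abs real_sqrt_le_mono)
      then show ?thesis using True by (auto simp: l_def u_def abs_le_iff)
    next
      case False
      then have "x \<notin> \<iota> ` interior_vertices V E"
        using interior_vertices_subset iota_in by (metis imageE subsetD)
      then have "f x = g x"
        using f by (simp add: admissible_def)
      then show ?thesis using False by (simp add: l_def u_def)
    qed
  qed
  then have "admissible g c0 c = {f. \<forall>x. l x \<le> f x \<and> f x \<le> u x} \<inter> admissible g c0 c"
    by blast
  then show ?thesis
    using compact_Int_closed[OF compact_box[of l u] closed_admissible[of g c0 c]] by simp
qed

lemma admissible_mono: "c \<le> c' \<Longrightarrow> admissible g c0 c \<subseteq> admissible g c0 c'"
  unfolding admissible_def by (blast intro: energy_le_mono)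

subsection \<open>Energy minimisers\<close>

text \<open>The admissible sets are compact and nested, so the infimum of the energies is attained.\<close>

lemma admissible_minimum:
  assumes b: "b \<in> B" and ne: "admissible g c0 c0 \<noteq> {}"
  obtains m f where "f \<in> admissible g c0 m" "m \<le> c0" "\<And>c. c < m \<Longrightarrow> admissible g c0 c = {}"
proof -
  let ?C = "{c. admissible g c0 c \<noteq> {}}"
  define m where "m = Inf ?C"
  have C: "bdd_below ?C"
    by (rule bdd_belowI[of _ 0]) (auto simp: admissible_def dest: energy_le_nonneg)
  have le: "m \<le> c" if "admissible g c0 c \<noteq> {}" for c
    unfolding m_def by (rule cInf_lower[OF _ C]) (use that in simp)
  define F where "F e = admissible g c0 (m + e)" for e
  have F_ne: "F e \<noteq> {}" if e: "0 < e" for e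
  proof -
    have "Inf ?C < m + e" using e by (simp add: m_def)
    then obtain c where "admissible g c0 c \<noteq> {}" "c < m + e"
      using cInf_lessD[of ?C "m + e"] ne by blast
    then show ?thesis using admissible_mono[of c "m + e" g c0] by (auto simp: F_def)
  qed
  \<comment> \<open>\<open>F 1\<close> is the compact set for the finite intersection property. The
    sets are nested, so a finite intersection contains the one with the smallest parameter.\<close>
  have "F 1 \<inter> (\<Inter>e\<in>{0<..}. F e) \<noteq> {}"
  proof (rule compact_imp_fip_image)
    show "compact (F 1)" unfolding F_def by (rule compact_admissible[OF b])
    show "closed (F e)" for e unfolding F_def by (rule closed_admissible)
    fix I :: "real set" assume I: "finite I" "I \<subseteq> {0<..}"
    define e where "e = Min (insert 1 I)"
    have "0 < e" using I by (auto simp: e_def)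
    moreover have "F e \<subseteq> F d" if "d \<in> insert 1 I" for d
      unfolding F_def e_def by (rule admissible_mono) (use I that in simp)
    ultimately show "F 1 \<inter> (\<Inter>d\<in>I. F d) \<noteq> {}"
      using F_ne[of e] by blast
  qed
  then obtain f where f: "\<And>e. 0 < e \<Longrightarrow> f \<in> F e" by blast
  have "energy_on S f \<le> m" if "finite S" "S \<subseteq> arcs" for S
    by (rule field_le_epsilon) (use f that in \<open>auto simp: F_def admissible_def energy_le_def\<close>)
  moreover have "f \<in> admissible g c0 (m + 1)" using f[of 1] by (simp add: F_def)
  ultimately have "f \<in> admissible g c0 m"
    by (auto simp: admissible_def energy_le_def)
  moreover have "m \<le> c0" using le ne by blast
  moreover have "admissible g c0 c = {}" if "c < m" for c using le that by force
  ultimately show thesis using that by blast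
qed

text \<open>Only arcs at \<open>v\<close> contribute to the difference. \<open>S\<close> contains
  them in both directions and \<open>R\<close> is symmetric, hence the factor 2.\<close>

lemma energy_on_single_change:
  assumes v: "v \<in> V" and h: "\<And>u. u \<in> V \<Longrightarrow> u \<noteq> v \<Longrightarrow> h (\<iota> u) = f (\<iota> u)"
    and S: "finite S" "S \<subseteq> arcs" "neighbours E v \<times> {v} \<subseteq> S" "{v} \<times> neighbours E v \<subseteq> S"
  shows "energy_on S h - energy_on S f =
    2 * (\<Sum>u\<in>neighbours E v. conductance E R u v *
       ((f (\<iota> u) - h (\<iota> v))\<^sup>2 - (f (\<iota> u) - f (\<iota> v))\<^sup>2))"
proof -
  let ?N = "neighbours E v"
  define T where "T = S - (?N \<times> {v} \<union> {v} \<times> ?N)"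
  have fin: "finite ?N" "finite T"
    using finite_neighbours(1)[OF v] S by (auto simp: T_def)
  have N: "u \<in> V" "u \<noteq> v" "R u v = R v u" "conductance E R u v = 1 / R u v" if "u \<in> ?N" for u
    using that edgeD[of u v] by (auto simp: neighbours_def conductance_def)
  have eq: "S = (?N \<times> {v} \<union> {v} \<times> ?N) \<union> T"
    using S by (auto simp: T_def)
  have split: "energy_on S k = 2 * (\<Sum>u\<in>?N. conductance E R u v * (k (\<iota> u) - k (\<iota> v))\<^sup>2)
      + energy_on T k" for k
  proof -
    have "energy_on S k = energy_on (?N \<times> {v} \<union> {v} \<times> ?N) k + energy_on T k"
      unfolding energy_on_def
      by (subst eq, rule sum.union_disjoint) (use fin in \<open>auto simp: T_def\<close>)
    also have "energy_on (?N \<times> {v} \<union> {v} \<times> ?N) k = energy_on (?N \<times> {v}) k + energy_on ({v} \<times> ?N) k"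
      unfolding energy_on_def by (rule sum.union_disjoint) (use fin N(2) in auto)
    also have "energy_on (?N \<times> {v}) k = (\<Sum>u\<in>?N. conductance E R u v * (k (\<iota> u) - k (\<iota> v))\<^sup>2)"
      unfolding energy_on_def by (simp add: sum.cartesian_product[symmetric] N(4) cong: sum.cong)
    also have "energy_on ({v} \<times> ?N) k = (\<Sum>u\<in>?N. conductance E R u v * (k (\<iota> u) - k (\<iota> v))\<^sup>2)"
      unfolding energy_on_def
      by (simp add: sum.cartesian_product[symmetric] N(3,4) power2_commute cong: sum.cong)
    finally show ?thesis by simp
  qed
  have "a \<in> V \<and> b \<in> V \<and> a \<noteq> v \<and> b \<noteq> v" if "(a, b) \<in> T" for a b
    using that S edgeD[of a b] by (auto simp: T_def arcs_def neighbours_def insert_commute)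
  then have "energy_on T h = energy_on T f"
    unfolding energy_on_def by (intro sum.cong) (auto simp: h)
  moreover have "(\<Sum>u\<in>?N. conductance E R u v * (h (\<iota> u) - h (\<iota> v))\<^sup>2) =
      (\<Sum>u\<in>?N. conductance E R u v * (f (\<iota> u) - h (\<iota> v))\<^sup>2)"
    by (rule sum.cong) (use N h in auto)
  ultimately show ?thesis
    by (simp add: split right_diff_distrib sum_subtractf)
qed

text \<open>\<open>\<iota> v\<close> is isolated in \<open>M\<close>, so its value does not affect
  continuity.\<close>

lemma continuous_single_change:
  fixes f :: "'b \<Rightarrow> real"
  assumes v: "v \<in> V" and f: "continuous_on M f"
  shows "continuous_on M (f(\<iota> v := a))"
proof -
  obtain \<delta> where \<delta>: "0 < \<delta>" "\<And>x. x \<in> M \<Longrightarrow> dist (\<iota> v) x < \<delta> \<Longrightarrow> x = \<iota> v"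
    using vertex_isolated[OF v] by metis
  show ?thesis
    unfolding continuous_on_iff
  proof (intro ballI allI impI)
    fix x and e :: real assume x: "x \<in> M" and e: "0 < e"
    show "\<exists>d>0. \<forall>y\<in>M. dist y x < d \<longrightarrow> dist ((f(\<iota> v := a)) y) ((f(\<iota> v := a)) x) < e"
    proof (cases "x = \<iota> v")
      case True
      show ?thesis
        by (rule exI[of _ \<delta>]) (use True \<delta> e in \<open>auto simp: dist_commute\<close>)
    next
      case False
      obtain d where d: "0 < d" "\<And>y. y \<in> M \<Longrightarrow> dist y x < d \<Longrightarrow> dist (f y) (f x) < e"
        using f x e unfolding continuous_on_iff by meson
      show ?thesis
        by (rule exI[of _ "min d \<delta>"]) (use False \<delta> d x in auto)
    qed
  qed
qed

text \<open>If the current balance \<open>s\<close> at an interior vertex were nonzero, resetting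
  the value there to the mean of the neighbours would lower the energy bound by
  \<open>2 * s\<^sup>2 / c\<close>, and the new function would still be admissible.\<close>

lemma minimizer_harmonic:
  assumes f: "f \<in> admissible g c0 m" and m: "m \<le> c0"
    and min: "\<And>c. c < m \<Longrightarrow> admissible g c0 c = {}"
  shows "harmonic_on_graph V E R (\<lambda>v. f (\<iota> v))"
  unfolding harmonic_iff
proof (rule ballI, rule ccontr)
  fix v assume int: "v \<in> interior_vertices V E"
  let ?N = "neighbours E v" and ?C = "\<lambda>u. conductance E R u v"
  define s where "s = (\<Sum>u\<in>?N. ?C u * (f (\<iota> u) - f (\<iota> v)))"
  define c where "c = (\<Sum>u\<in>?N. ?C u)"
  assume "(\<Sum>u\<in>?N. ?C u * (f (\<iota> u) - f (\<iota> v))) \<noteq> 0"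
  then have s: "s \<noteq> 0" by (simp add: s_def)
  have v: "v \<in> V" using int interior_vertices_subset by blast
  have c: "0 < c"
    unfolding c_def by (intro sum_pos finite_neighbours[OF v] conductance_pos)
  \<comment> \<open>\<open>f (\<iota> v) + s / c\<close> is the conductance-weighted mean over the
    neighbours, the minimiser of the local quadratic energy.\<close>
  define h where "h = f(\<iota> v := f (\<iota> v) + s / c)"
  have en: "energy_le f m" using f by (simp add: admissible_def)
  have "continuous_on M f"
    by (rule hoelder_continuous[of c0])
      (use f m energy_le_nonneg[OF en] in \<open>auto simp: admissible_def\<close>)
  then have h_cont: "continuous_on M h"
    unfolding h_def by (rule continuous_single_change[OF v])
  have h_eq: "h (\<iota> u) = f (\<iota> u)" if "u \<in> V" "u \<noteq> v" for u
    using that v inj_onD[OF inj_iota, of u v] by (auto simp: h_def)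
  have drop: "2 * (\<Sum>u\<in>?N. ?C u * ((f (\<iota> u) - h (\<iota> v))\<^sup>2 - (f (\<iota> u) - f (\<iota> v))\<^sup>2)) = - 2 * s\<^sup>2 / c"
  proof -
    have "(\<Sum>u\<in>?N. ?C u * ((f (\<iota> u) - h (\<iota> v))\<^sup>2 - (f (\<iota> u) - f (\<iota> v))\<^sup>2)) =
        (\<Sum>u\<in>?N. ?C u * (s / c)\<^sup>2 - 2 * (s / c) * (?C u * (f (\<iota> u) - f (\<iota> v))))"
      by (rule sum.cong) (auto simp: h_def power2_eq_square algebra_simps)
    also have "\<dots> = c * (s / c)\<^sup>2 - 2 * (s / c) * s"
      by (simp add: sum_subtractf c_def s_def sum_distrib_left sum_distrib_right)
    also have "\<dots> = - s\<^sup>2 / c"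
      using c by (simp add: power2_eq_square field_simps)
    finally show ?thesis by simp
  qed
  have h_en: "energy_le h (m - 2 * s\<^sup>2 / c)"
    unfolding energy_le_def
  proof (intro allI impI)
    fix S assume S: "finite S" "S \<subseteq> arcs"
    \<comment> \<open>Adding all arcs at \<open>v\<close> can only increase the energy of
      \<open>h\<close>, and makes the exact drop available.\<close>
    define T where "T = S \<union> ?N \<times> {v} \<union> {v} \<times> ?N"
    have T: "finite T" "T \<subseteq> arcs" "S \<subseteq> T" "?N \<times> {v} \<subseteq> T" "{v} \<times> ?N \<subseteq> T"
      using S finite_neighbours(1)[OF v] by (auto simp: T_def arcs_def neighbours_def insert_commute)
    have "energy_on S h \<le> energy_on T h" by (rule energy_on_mono[OF T(1,3,2)])
    also have "\<dots> = energy_on T f + (- 2 * s\<^sup>2 / c)"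
      using energy_on_single_change[of v h f T] v h_eq T drop by simp
    also have "energy_on T f \<le> m" using en T by (simp add: energy_le_def)
    finally show "energy_on S h \<le> m - 2 * s\<^sup>2 / c" by simp
  qed
  have pos: "0 < 2 * s\<^sup>2 / c" using s c by simp
  have "h \<in> admissible g c0 (m - 2 * s\<^sup>2 / c)"
    unfolding admissible_def
  proof (intro CollectI conjI allI ballI impI)
    show "h x = g x" if "x \<notin> \<iota> ` interior_vertices V E" for x
      using that f int by (auto simp: h_def admissible_def)
    \<comment> \<open>The energy of \<open>h\<close> is below \<open>m\<close>, hence below
      \<open>c0\<close>, and an energy bound \<open>c0\<close> already implies this
      estimate.\<close>
    show "(h x - h y)\<^sup>2 \<le> c0 * dist x y" if "x \<in> M" "y \<in> M" for x y
      by (rule energy_hoelder[OF energy_le_mono[OF h_en] h_cont that]) (use pos m in linarith)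
  qed (rule h_en)
  then show False using min[of "m - 2 * s\<^sup>2 / c"] pos by auto
qed

text \<open>Finitely many jumps give \<open>g\<close> finite energy \<open>c0\<close>, which serves
  also as the Hoelder constant. Thus \<open>g\<close> is itself admissible and a minimiser with its
  boundary values exists.\<close>

lemma harmonic_extension_finite_jumps:
  assumes b: "B \<noteq> {}" and g: "continuous_on M g"
    and fin: "finite {(u, v) \<in> arcs. g (\<iota> u) \<noteq> g (\<iota> v)}"
  obtains f where "continuous_on M f" "\<And>x. x \<in> B \<Longrightarrow> f x = g x"
    "harmonic_on_graph V E R (\<lambda>v. f (\<iota> v))"
proof -
  let ?J = "{(u, v) \<in> arcs. g (\<iota> u) \<noteq> g (\<iota> v)}"
  define c0 where "c0 = energy_on ?J g"
  have en: "energy_le g c0"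
    unfolding energy_le_def
  proof (intro allI impI)
    fix S assume S: "finite S" "S \<subseteq> arcs"
    have "energy_on S g = energy_on (S \<inter> ?J) g"
      unfolding energy_on_def
      by (rule sum.mono_neutral_right) (use S in auto)
    also have "\<dots> \<le> c0"
      unfolding c0_def by (rule energy_on_mono) (use fin in auto)
    finally show "energy_on S g \<le> c0" .
  qed
  have "g \<in> admissible g c0 c0"
    using en energy_hoelder[OF en g] by (simp add: admissible_def)
  moreover obtain b where "b \<in> B" using b by blast
  ultimately obtain m f where f: "f \<in> admissible g c0 m" "m \<le> c0"
      "\<And>c. c < m \<Longrightarrow> admissible g c0 c = {}"
    using admissible_minimum[of b g c0] by blast
  show thesis
  proof
    show "continuous_on M f"
      by (rule hoelder_continuous[OF energy_le_nonneg[OF en]])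
        (use f in \<open>auto simp: admissible_def\<close>)
    show "f x = g x" if "x \<in> B" for x
      using f(1) that by (simp add: admissible_def graph_boundary_def)
    show "harmonic_on_graph V E R (\<lambda>v. f (\<iota> v))"
      by (rule minimizer_harmonic[OF f])
  qed
qed

subsection \<open>Components after deleting finitely many edges\<close>

definition component :: "'v set set \<Rightarrow> 'v \<Rightarrow> 'v set" where
  "component W a = (adjacent_off W)\<^sup>* `` {a}"

text \<open>Taking the closure extends the indicator of a component to limit points. Components keep
  a positive distance, so this closure is open and closed in \<open>M\<close>.\<close>

definition component_indicator :: "'v set set \<Rightarrow> 'v \<Rightarrow> 'b \<Rightarrow> real" where
  "component_indicator W a x = (if x \<in> closure (\<iota> ` component W a) then 1 else 0)"

lemma component_closed:
  assumes "u \<in> component W a" "(u, v) \<in> (adjacent_off W)\<^sup>*"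
  shows "v \<in> component W a"
  using assms unfolding component_def by (blast intro: rtrancl_trans)

lemma component_subset: "a \<in> V \<Longrightarrow> component W a \<subseteq> V"
  unfolding component_def by (blast intro: reachable_off_in)

lemma closure_component_close:
  assumes a: "a \<in> V" and \<delta>: "\<And>u v. {u, v} \<in> W \<Longrightarrow> \<delta> \<le> R u v"
    and x: "x \<in> closure (\<iota> ` component W a)" and y: "y \<in> M" and xy: "dist x y < \<delta>"
  shows "y \<in> closure (\<iota> ` component W a)"
  unfolding closure_approachable
proof (intro allI impI)
  fix e :: real assume e: "0 < e"
  \<comment> \<open>Half the slack, so that approximating both \<open>x\<close> and \<open>y\<close>
    by vertices keeps the total below \<delta>.\<close>
  define d where "d = (\<delta> - dist x y) / 2"
  have d: "0 < d" using xy by (simp add: d_def)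
  obtain u where u: "u \<in> component W a" "dist (\<iota> u) x < d"
    using x d unfolding closure_approachable by blast
  obtain w where w: "w \<in> V" "dist (\<iota> w) y < min e d"
    using dense[OF y, of "min e d"] d e by auto
  have "dist (\<iota> u) (\<iota> w) \<le> dist (\<iota> u) x + dist x y + dist (\<iota> w) y"
    by metric
  also have "\<dots> < \<delta>" using u(2) w(2) by (simp add: d_def field_simps)
  finally have "(u, w) \<in> (adjacent_off W)\<^sup>*"
    using close_reachable_off[OF _ w(1) _ \<delta>] component_subset[OF a] u(1) by blast
  then have "w \<in> component W a" using component_closed u(1) by blast
  then show "\<exists>y'\<in>\<iota> ` component W a. dist y' y < e" using w(2) by auto
qed

lemma vertex_in_closure_component:
  assumes W: "finite W" "W \<subseteq> E" and a: "a \<in> V" and u: "u \<in> V"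
  shows "\<iota> u \<in> closure (\<iota> ` component W a) \<longleftrightarrow> u \<in> component W a"
proof
  obtain \<delta> where \<delta>: "0 < \<delta>" "\<And>u v. {u, v} \<in> W \<Longrightarrow> \<delta> \<le> R u v"
    using edge_resistance_bound[OF W] by blast
  assume "\<iota> u \<in> closure (\<iota> ` component W a)"
  then obtain w where w: "w \<in> component W a" "dist (\<iota> w) (\<iota> u) < \<delta>"
    using \<delta>(1) unfolding closure_approachable by blast
  then have "(w, u) \<in> (adjacent_off W)\<^sup>*"
    using close_reachable_off[OF _ u _ \<delta>(2)] component_subset[OF a] by blast
  then show "u \<in> component W a" using component_closed w(1) by blast
next
  assume "u \<in> component W a"
  then show "\<iota> u \<in> closure (\<iota> ` component W a)"
    by (intro subsetD[OF closure_subset] imageI)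
qed

lemma component_indicator_continuous:
  assumes W: "finite W" "W \<subseteq> E" and a: "a \<in> V"
  shows "continuous_on M (component_indicator W a)"
proof -
  obtain \<delta> where \<delta>: "0 < \<delta>" "\<And>u v. {u, v} \<in> W \<Longrightarrow> \<delta> \<le> R u v"
    using edge_resistance_bound[OF W] by blast
  have "component_indicator W a y = component_indicator W a x"
    if "x \<in> M" "y \<in> M" "dist y x < \<delta>" for x y
    using closure_component_close[OF a \<delta>(2), where x = x and y = y]
      closure_component_close[OF a \<delta>(2), where x = y and y = x] that
    by (auto simp: component_indicator_def dist_commute)
  then show ?thesis
    using \<delta>(1) unfolding continuous_on_iff by (metis dist_self)
qed

text \<open>The ends of an edge outside \<open>W\<close> lie in the same component, so only edges of
  \<open>W\<close> carry jumps.\<close>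

lemma component_indicator_jumps:
  assumes W: "finite W" "W \<subseteq> E" and a: "a \<in> V"
  shows "finite {(u, v) \<in> arcs. component_indicator W a (\<iota> u) \<noteq> component_indicator W a (\<iota> v)}"
proof (rule finite_subset[OF _ finite_arcs_of[OF W]], clarify, rule ccontr)
  fix u v assume uv: "(u, v) \<in> arcs" "{u, v} \<notin> W"
    and ne: "component_indicator W a (\<iota> u) \<noteq> component_indicator W a (\<iota> v)"
  have "(u, v) \<in> adjacent_off W" "(v, u) \<in> adjacent_off W"
    using uv by (auto simp: arcs_def adjacent_off_def insert_commute)
  then have "u \<in> component W a \<longleftrightarrow> v \<in> component W a"
    using component_closed by blast
  moreover have "u \<in> V" "v \<in> V" using uv edgeD by (auto simp: arcs_def)
  ultimately show False
    using ne vertex_in_closure_component[OF W a] by (simp add: component_indicator_def)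
qed

section \<open>Walks, rays and double rays that avoid \<open>W\<close>\<close>

abbreviation (input) "walk W \<equiv> successively (\<lambda>u v. (u, v) \<in> adjacent_off W)"

lemma obtain_walk:
  assumes "(a, u) \<in> (adjacent_off W)\<^sup>*"
  obtains xs where "xs \<noteq> []" "hd xs = a" "last xs = u" "walk W xs"
proof -
  have "\<exists>xs. xs \<noteq> [] \<and> hd xs = a \<and> last xs = u \<and> walk W xs"
    using assms
  proof (induction rule: rtrancl_induct)
    case base
    show ?case by (rule exI[of _ "[a]"]) simp
  next
    case (step u v)
    then obtain xs where "xs \<noteq> []" "hd xs = a" "last xs = u" "walk W xs" by blast
    then show ?case
      using step by (intro exI[of _ "xs @ [v]"]) (auto simp: successively_append_iff)
  qed
  then show thesis using that by blast
qed

text \<open>A path shorter than \<eta> avoids \<open>W\<close> and never leaves the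
  \<eta>-neighbourhood of its start. The start is omitted from \<open>ys\<close>, ready for
  appending to a walk that ends in \<open>u\<close>.\<close>

lemma obtain_walk_extension:
  assumes uv: "u \<in> V" "v \<in> V" "u \<noteq> v" "dist (\<iota> u) (\<iota> v) < \<eta>"
    and \<eta>: "\<And>u v. {u, v} \<in> W \<Longrightarrow> \<eta> \<le> R u v"
  obtains ys where "ys \<noteq> []" "walk W (u # ys)" "last ys = v"
    "\<And>w. w \<in> set ys \<Longrightarrow> dist (\<iota> u) (\<iota> w) < \<eta>"
proof -
  obtain K p where p: "finite_path V E K p" "p 0 = u" "p K = v" "path_length R K p < \<eta>"
    using obtain_path[OF uv(1,2,4)] by blast
  have K: "0 < K" using p uv(3) by (cases K) auto
  have eq: "u # map p [1..<Suc K] = map p [0..<Suc K]"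
    using p(2) by (simp add: upt_conv_Cons del: upt_Suc)
  show thesis
  proof
    show "map p [1..<Suc K] \<noteq> []" "last (map p [1..<Suc K]) = v"
      using K p(3) by auto
    show "walk W (u # map p [1..<Suc K])"
      unfolding eq successively_conv_nth
      using finite_pathD(1)[OF p(1)] short_path_avoids[OF p(1,4) \<eta>]
      by (auto simp: adjacent_off_def simp del: upt_Suc)
    show "dist (\<iota> u) (\<iota> w) < \<eta>" if w: "w \<in> set (map p [1..<Suc K])" for w
    proof -
      obtain k where "w = p k" "k \<le> K" using w by auto
      then show ?thesis using dist_along_path[OF p(1), of k] p by simp
    qed
  qed
qed

text \<open>The ray is the union of an increasing sequence of walks, the \<open>n\<close>-th of which ends within
  \<open>\<delta> / 2 ^ (n + 1)\<close> of the limit point and is continued by a walk of length less than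
  \<open>\<delta> / 2 ^ n\<close>, too short to use an edge of \<open>W\<close>.\<close>

lemma ray_to_limit:
  assumes W: "finite W" "W \<subseteq> E" and a: "a \<in> V" and x: "x \<in> M" "x \<notin> \<iota> ` V"
    and cl: "x \<in> closure (\<iota> ` component W a)"
  obtains p where "ray V E p" "p 0 = a" "(\<lambda>k. \<iota> (p k)) \<longlonglongrightarrow> x" "\<And>k. {p k, p (Suc k)} \<notin> W"
proof -
  obtain \<delta> where \<delta>: "0 < \<delta>" "\<And>u v. {u, v} \<in> W \<Longrightarrow> \<delta> \<le> R u v"
    using edge_resistance_bound[OF W] by blast
  define \<eta> where "\<eta> n = \<delta> * (1 / 2) ^ n" for n
  have \<eta>_pos: "0 < \<eta> n" for n using \<delta>(1) by (simp add: \<eta>_def)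
  have \<eta>_Suc: "\<eta> n = 2 * \<eta> (Suc n)" for n by (simp add: \<eta>_def)
  have \<eta>_mono: "\<eta> m \<le> \<eta> n" if "n \<le> m" for m n
    using that \<delta>(1) by (simp add: \<eta>_def power_decreasing)
  have \<eta>_le: "\<eta> n \<le> \<delta>" for n using \<eta>_mono[of 0 n] by (simp add: \<eta>_def)
  \<comment> \<open>\<open>P\<close> is the invariant of the walk at stage \<open>n\<close>.
    \<open>Q\<close> keeps all newly added vertices near \<open>x\<close>, not just the last one,
    which is what makes the whole ray converge.\<close>
  define P where "P n xs \<longleftrightarrow> xs \<noteq> [] \<and> hd xs = a \<and> walk W xs \<and> last xs \<in> V \<and>
    dist (\<iota> (last xs)) x < \<eta> (Suc n)" for n xs
  define Q where "Q n xs ys \<longleftrightarrow> (\<exists>zs. zs \<noteq> [] \<and> ys = xs @ zs \<and>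
    (\<forall>w\<in>set zs. dist (\<iota> w) x < 2 * \<eta> n))" for n and xs ys :: "'v list"
  have "\<exists>L. \<forall>n. P n (L n) \<and> Q n (L n) (L (Suc n))"
  proof (rule dependent_nat_choice)
    obtain u where u: "u \<in> component W a" "dist (\<iota> u) x < \<eta> 1"
      using cl \<eta>_pos[of 1] unfolding closure_approachable by blast
    then have "(a, u) \<in> (adjacent_off W)\<^sup>*" by (simp add: component_def)
    then obtain xs where "xs \<noteq> []" "hd xs = a" "last xs = u" "walk W xs"
      using obtain_walk by blast
    then show "\<exists>xs. P 0 xs"
      using u component_subset[OF a] by (auto simp: P_def)
  next
    fix xs n assume xs: "P n xs"
    define u where "u = last xs"
    have u: "u \<in> V" "dist (\<iota> u) x < \<eta> (Suc n)" using xs by (auto simp: P_def u_def)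
    \<comment> \<open>Since \<open>x\<close> is not a vertex, a strictly closer vertex
      \<open>v\<close> exists; it differs from \<open>u\<close>, so the walk really grows.\<close>
    have "0 < dist (\<iota> u) x" using x(2) u(1) by auto
    then obtain v where v: "v \<in> V" "dist (\<iota> v) x < min (dist (\<iota> u) x) (\<eta> (Suc (Suc n)))"
      using dense[OF x(1)] \<eta>_pos by (metis min_less_iff_conj)
    have "u \<noteq> v" using v(2) by auto
    moreover have "dist (\<iota> u) (\<iota> v) < \<eta> n"
    proof -
      have "dist (\<iota> u) (\<iota> v) \<le> dist (\<iota> u) x + dist (\<iota> v) x" by metric
      then show ?thesis using u v \<eta>_Suc[of n] \<eta>_mono[of "Suc n" "Suc (Suc n)"] by simp
    qed
    moreover have "\<eta> n \<le> R u v" if "{u, v} \<in> W" for u v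
      using \<delta>(2)[OF that] \<eta>_le[of n] by simp
    ultimately obtain zs where zs: "zs \<noteq> []" "walk W (u # zs)" "last zs = v"
        "\<And>w. w \<in> set zs \<Longrightarrow> dist (\<iota> u) (\<iota> w) < \<eta> n"
      using obtain_walk_extension[OF u(1) v(1), of "\<eta> n" W] by blast
    have "walk W (xs @ zs)"
      using xs zs(1,2) by (auto simp: P_def u_def successively_append_iff successively_Cons)
    then have "P (Suc n) (xs @ zs)"
      using xs zs v by (auto simp: P_def)
    moreover have "dist (\<iota> w) x < 2 * \<eta> n" if "w \<in> set zs" for w
    proof -
      have "dist (\<iota> w) x \<le> dist (\<iota> u) (\<iota> w) + dist (\<iota> u) x" by metric
      then show ?thesis using zs(4)[OF that] u(2) \<eta>_Suc[of n] \<eta>_pos[of "Suc n"] by simp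
    qed
    ultimately show "\<exists>ys. P (Suc n) ys \<and> Q n xs ys"
      using zs(1) by (auto simp: Q_def)
  qed
  then obtain L where P: "\<And>n. P n (L n)" and Q: "\<And>n. Q n (L n) (L (Suc n))" by blast
  have len: "n < length (L n)" for n
  proof (induction n)
    case 0
    then show ?case using P[of 0] by (simp add: P_def)
  next
    case (Suc n)
    obtain zs where "zs \<noteq> []" "L (Suc n) = L n @ zs" using Q[of n] by (auto simp: Q_def)
    then show ?case using Suc by (cases zs) auto
  qed
  have prefix: "k < length (L m) \<and> L m ! k = L n ! k" if "n \<le> m" "k < length (L n)" for k m n
    using that
  proof (induction m rule: dec_induct)
    case (step m)
    obtain zs where "L (Suc m) = L m @ zs" using Q[of m] by (auto simp: Q_def)
    then show ?case using step by (auto simp: nth_append)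
  qed simp
  \<comment> \<open>The diagonal is well defined since \<open>L k\<close> has more than
    \<open>k\<close> entries, and it agrees with every walk by the prefix property.\<close>
  define p where "p k = L k ! k" for k
  have p: "L m ! k = p k" if "k < length (L m)" for k m
    using prefix[of k m k] prefix[of m k k] len[of k] that by (cases "k \<le> m") (auto simp: p_def)
  have step: "(p k, p (Suc k)) \<in> adjacent_off W" for k
  proof -
    have "walk W (L (Suc k))" using P[of "Suc k"] by (simp add: P_def)
    then have "(L (Suc k) ! k, L (Suc k) ! Suc k) \<in> adjacent_off W"
      using successively_nth len by blast
    then show ?thesis
      using p[of k "Suc k"] p[of "Suc k" "Suc k"] len[of "Suc k"] by simp
  qed
  \<comment> \<open>Entries beyond the length of \<open>L n\<close> were added at stage
    \<open>n\<close> or later.\<close>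
  have near: "dist (\<iota> (L m ! k)) x < 2 * \<eta> n"
    if "n \<le> m" "length (L n) \<le> k" "k < length (L m)" for m n k
    using that
  proof (induction m rule: dec_induct)
    case (step m)
    obtain zs where zs: "L (Suc m) = L m @ zs" "\<And>w. w \<in> set zs \<Longrightarrow> dist (\<iota> w) x < 2 * \<eta> m"
      using Q[of m] by (auto simp: Q_def)
    show ?case
    proof (cases "k < length (L m)")
      case False
      then have "L (Suc m) ! k \<in> set zs" using step.prems zs(1) by (simp add: nth_append)
      then show ?thesis using zs(2) \<eta>_mono[OF step.hyps(1)] by force
    qed (use step zs(1) in \<open>simp add: nth_append\<close>)
  qed simp
  show thesis
  proof
    show "ray V E p"
      using step by (auto simp: ray_def adjacent_off_def dest: edgeD)
    show "p 0 = a" using P[of 0] hd_conv_nth[of "L 0"] by (simp add: P_def p_def)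
    show "{p k, p (Suc k)} \<notin> W" for k using step[of k] by (simp add: adjacent_off_def)
    show "(\<lambda>k. \<iota> (p k)) \<longlonglongrightarrow> x"
    proof (rule metric_LIMSEQ_I)
      fix e :: real assume "0 < e"
      then obtain n where "(1 / 2) ^ n < e / (2 * \<delta>)"
        using real_arch_pow_inv[of "e / (2 * \<delta>)" "1 / 2"] \<delta>(1) by auto
      then have n: "2 * \<eta> n < e" using \<delta>(1) by (simp add: \<eta>_def field_simps)
      have "dist (\<iota> (p k)) x < e" if k: "length (L n) \<le> k" for k
        using near[of n k k] len[of n] len[of k] k n by (simp add: p_def)
      then show "\<exists>N. \<forall>k\<ge>N. dist (\<iota> (p k)) x < e" by blast
    qed
  qed
qed

lemma double_ray_of_rays:
  fixes p q :: "nat \<Rightarrow> 'v"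
  assumes p: "ray V E p" "(\<lambda>k. \<iota> (p k)) \<longlonglongrightarrow> x" "\<And>k. {p k, p (Suc k)} \<notin> W"
    and q: "ray V E q" "(\<lambda>k. \<iota> (q k)) \<longlonglongrightarrow> y" "\<And>k. {q k, q (Suc k)} \<notin> W"
    and eq: "p 0 = q 0"
  obtains D where "path_between V E \<iota> x y D" "D \<inter> W = {}"
proof -
  \<comment> \<open>\<open>p\<close> is run backwards on the negative indices and \<open>q\<close>
    forwards on the others; they fit together since \<open>p 0 = q 0\<close>.\<close>
  define r where "r k = (if 0 \<le> k then q (nat k) else p (nat (- k)))" for k :: int
  have edge: "\<exists>j. {r k, r (k + 1)} = {q j, q (Suc j)} \<or> {r k, r (k + 1)} = {p j, p (Suc j)}" for k
  proof (cases "0 \<le> k")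
    case True
    then have "{r k, r (k + 1)} = {q (nat k), q (Suc (nat k))}"
      by (simp add: r_def Suc_nat_eq_nat_zadd1 add.commute)
    then show ?thesis by blast
  next
    case False
    define j where "j = nat (- k - 1)"
    have "k = - int (Suc j)" using False by (simp add: j_def)
    then have "nat (- k) = Suc j" "nat (- (k + 1)) = j" "k + 1 = 0 \<longleftrightarrow> j = 0" by auto
    then have "r k = p (Suc j)" "r (k + 1) = p j"
      using False eq by (auto simp: r_def)
    then show ?thesis by (metis insert_commute)
  qed
  have "double_ray V E r"
    unfolding double_ray_def
  proof (intro conjI allI)
    show "r k \<in> V" for k using p(1) q(1) by (simp add: r_def ray_def)
    show "{r k, r (k + 1)} \<in> E" for k using edge[of k] p(1) q(1) by (auto simp: ray_def)
  qed
  moreover have "((\<lambda>k. \<iota> (r k)) \<longlongrightarrow> x) at_bot"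
    unfolding tendsto_iff eventually_at_bot_linorder
  proof (intro allI impI)
    fix e :: real assume "0 < e"
    then obtain N where N: "\<And>n. N \<le> n \<Longrightarrow> dist (\<iota> (p n)) x < e"
      using metric_LIMSEQ_D[OF p(2)] by blast
    show "\<exists>K. \<forall>k\<le>K. dist (\<iota> (r k)) x < e"
      by (rule exI[of _ "- int N - 1"]) (auto simp: r_def intro!: N)
  qed
  moreover have "((\<lambda>k. \<iota> (r k)) \<longlongrightarrow> y) at_top"
    unfolding tendsto_iff eventually_at_top_linorder
  proof (intro allI impI)
    fix e :: real assume "0 < e"
    then obtain N where N: "\<And>n. N \<le> n \<Longrightarrow> dist (\<iota> (q n)) y < e"
      using metric_LIMSEQ_D[OF q(2)] by blast
    show "\<exists>K. \<forall>k\<ge>K. dist (\<iota> (r k)) y < e"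
      by (rule exI[of _ "int N"]) (auto simp: r_def intro!: N)
  qed
  ultimately have "path_between V E \<iota> x y {{r k, r (k + 1)} | k. True}"
    unfolding path_between_def by blast
  moreover have "{{r k, r (k + 1)} | k. True} \<inter> W = {}"
  proof (rule equals0I)
    fix e assume "e \<in> {{r k, r (k + 1)} | k. True} \<inter> W"
    then obtain k where "e = {r k, r (k + 1)}" "e \<in> W" by blast
    then show False using edge[of k] p(3) q(3) by auto
  qed
  ultimately show thesis using that by blast
qed

lemma finite_path_of_reachable:
  assumes a: "a \<in> V" and "(a, u) \<in> (adjacent_off W)\<^sup>*"
  obtains K p where "finite_path V E K p" "p 0 = a" "p K = u" "\<And>k. k < K \<Longrightarrow> {p k, p (Suc k)} \<notin> W"
proof -
  obtain xs where xs: "xs \<noteq> []" "hd xs = a" "last xs = u" "walk W xs"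
    using obtain_walk[OF assms(2)] by blast
  let ?p = "(!) xs" and ?K = "length xs - 1"
  have step: "(?p k, ?p (Suc k)) \<in> adjacent_off W" if "k < ?K" for k
    using successively_nth[OF xs(4), of k] that by simp
  have in_V: "?p k \<in> V" if "k \<le> ?K" for k
  proof (cases k)
    case 0
    then show ?thesis using a xs by (simp add: hd_conv_nth)
  next
    case (Suc j)
    then show ?thesis using step[of j] that by (auto simp: adjacent_off_def dest: edgeD)
  qed
  show thesis
  proof
    show "finite_path V E ?K ?p"
      using step in_V by (auto simp: finite_path_def adjacent_off_def)
    show "?p 0 = a" "?p ?K = u" using xs by (simp_all add: hd_conv_nth last_conv_nth)
    show "{?p k, ?p (Suc k)} \<notin> W" if "k < ?K" for k
      using step[OF that] by (simp add: adjacent_off_def)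
  qed
qed

text \<open>A point is a vertex or a limit of a ray, giving a finite path, a ray or a double ray.
  The premise \<open>order\<close> excludes a limit point \<open>x\<close> with a vertex
  \<open>y\<close>, because \<open>path_between\<close> contains rays only in the forward
  direction.\<close>

lemma path_in_component:
  assumes W: "finite W" "W \<subseteq> E" and a: "a \<in> V" and xy: "x \<in> M" "y \<in> M"
    and cl: "x \<in> closure (\<iota> ` component W a)" "y \<in> closure (\<iota> ` component W a)"
    and order: "y \<in> \<iota> ` V \<Longrightarrow> x \<in> \<iota> ` V"
  obtains D where "path_between V E \<iota> x y D" "D \<inter> W = {}"
proof (cases "x \<in> \<iota> ` V")
  case True
  then obtain u where u: "u \<in> V" "x = \<iota> u" by blast
  have au: "(a, u) \<in> (adjacent_off W)\<^sup>*"
    using vertex_in_closure_component[OF W a u(1)] cl(1) u(2) by (simp add: component_def)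
  \<comment> \<open>The component is based at \<open>u\<close> so that the path or ray can start
    there.\<close>
  have "component W u = component W a"
    using au reachable_off_sym[OF au] by (auto simp: component_def intro: rtrancl_trans)
  then have cl_u: "y \<in> closure (\<iota> ` component W u)" using cl(2) by simp
  show thesis
  proof (cases "y \<in> \<iota> ` V")
    case True
    then obtain v where v: "v \<in> V" "y = \<iota> v" by blast
    have "(u, v) \<in> (adjacent_off W)\<^sup>*"
      using vertex_in_closure_component[OF W u(1) v(1)] cl_u v(2) by (simp add: component_def)
    then obtain K p where p: "finite_path V E K p" "p 0 = u" "p K = v"
        "\<And>k. k < K \<Longrightarrow> {p k, p (Suc k)} \<notin> W"
      using finite_path_of_reachable[OF u(1)] by blast
    have "path_between V E \<iota> x y {{p k, p (Suc k)} | k. k < K}"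
      unfolding path_between_def using p u v by blast
    then show thesis using that p(4) by blast
  next
    case False
    obtain p where p: "ray V E p" "p 0 = u" "(\<lambda>k. \<iota> (p k)) \<longlonglongrightarrow> y" "\<And>k. {p k, p (Suc k)} \<notin> W"
      using ray_to_limit[OF W u(1) xy(2) False cl_u] by blast
    have "path_between V E \<iota> x y {{p k, p (Suc k)} | k. True}"
      unfolding path_between_def using p u by blast
    then show thesis using that p(4) by blast
  qed
next
  case False
  obtain p where p: "ray V E p" "p 0 = a" "(\<lambda>k. \<iota> (p k)) \<longlonglongrightarrow> x" "\<And>k. {p k, p (Suc k)} \<notin> W"
    using ray_to_limit[OF W a xy(1) False cl(1)] by blast
  have "y \<notin> \<iota> ` V" using order False by blast
  then obtain q where q: "ray V E q" "q 0 = a" "(\<lambda>k. \<iota> (q k)) \<longlonglongrightarrow> y" "\<And>k. {q k, q (Suc k)} \<notin> W"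
    using ray_to_limit[OF W a xy(2) _ cl(2)] by blast
  show thesis
    using double_ray_of_rays[OF p(1,3,4) q(1,3,4)] p(2) q(2) that by metis
qed

subsection \<open>Approximation of boundary data\<close>

text \<open>The functions whose boundary values the energy method can handle; they form the algebra
  for Stone--Weierstrass.\<close>

definition tame :: "('b \<Rightarrow> real) \<Rightarrow> bool" where
  "tame f \<longleftrightarrow> continuous_on M f \<and> finite {(u, v) \<in> arcs. f (\<iota> u) \<noteq> f (\<iota> v)}"

lemma tame_separates:
  assumes wc: "weakly_connected V E \<iota> M" and xy: "x \<in> M" "y \<in> M" "x \<noteq> y"
  shows "\<exists>f. tame f \<and> f x \<noteq> f y"
proof -
  have *: "\<exists>f. tame f \<and> f x \<noteq> f y"
    if xy: "x \<in> M" "y \<in> M" "x \<noteq> y" and order: "y \<in> \<iota> ` V \<Longrightarrow> x \<in> \<iota> ` V" for x y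
  proof -
    obtain W where W: "finite W" "W \<subseteq> E" "\<And>D. path_between V E \<iota> x y D \<Longrightarrow> D \<inter> W \<noteq> {}"
      using wc xy unfolding weakly_connected_def by meson
    obtain \<delta> where \<delta>: "0 < \<delta>" "\<And>u v. {u, v} \<in> W \<Longrightarrow> \<delta> \<le> R u v"
      using edge_resistance_bound[OF W(1,2)] by blast
    obtain a where a: "a \<in> V" "dist (\<iota> a) x < \<delta>" using dense[OF xy(1) \<delta>(1)] by blast
    have "\<iota> a \<in> closure (\<iota> ` component W a)"
      using closure_subset by (force simp: component_def)
    then have x: "x \<in> closure (\<iota> ` component W a)"
      using closure_component_close[OF a(1) \<delta>(2) _ xy(1) a(2)] by blast
    have "y \<notin> closure (\<iota> ` component W a)"
      using path_in_component[OF W(1,2) a(1) xy(1,2) x _ order] W(3) by metis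
    then have "component_indicator W a x \<noteq> component_indicator W a y"
      using x by (simp add: component_indicator_def)
    then show ?thesis
      using component_indicator_continuous[OF W(1,2) a(1)] component_indicator_jumps[OF W(1,2) a(1)]
      unfolding tame_def by blast
  qed
  \<comment> \<open>One of the two orders always satisfies the side condition, and separation is
    symmetric.\<close>
  show ?thesis using *[of x y] *[of y x] xy by metis
qed

lemma tame_approximation:
  assumes wc: "weakly_connected V E \<iota> M" and M: "compact M"
    and F: "continuous_on B F" and e: "0 < e"
  obtains g where "tame g" "\<And>x. x \<in> B \<Longrightarrow> \<bar>F x - g x\<bar> < e"
proof -
  have sub: "B \<subseteq> M" by (auto simp: graph_boundary_def)
  \<comment> \<open>A pointwise combination can jump only across an arc where \<open>f\<close> or
    \<open>g\<close> jumps.\<close>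
  have comb: "tame (\<lambda>x. h (f x) (g x))" if "tame f" "tame g"
    "continuous_on M (\<lambda>x. h (f x) (g x))" for f g h
  proof -
    have "finite ({(u, v) \<in> arcs. f (\<iota> u) \<noteq> f (\<iota> v)} \<union> {(u, v) \<in> arcs. g (\<iota> u) \<noteq> g (\<iota> v)})"
      using that by (simp add: tame_def)
    then show ?thesis
      unfolding tame_def by (intro conjI that(3)) (erule rev_finite_subset, auto)
  qed
  have "\<exists>g. tame g \<and> (\<forall>x\<in>B. \<bar>F x - g x\<bar> < e)"
  proof (rule Stone_Weierstrass_HOL[OF compact_boundary[OF M] _ _ _ _ _ F e])
    show "tame (\<lambda>x. c)" for c by (simp add: tame_def)
    show "continuous_on B f" if "tame f" for f
      using that continuous_on_subset[OF _ sub] by (auto simp: tame_def)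
    show "tame (\<lambda>x. f x + g x)" if "tame f \<and> tame g" for f g
      by (rule comb) (use that in \<open>auto simp: tame_def intro: continuous_on_add\<close>)
    show "tame (\<lambda>x. f x * g x)" if "tame f \<and> tame g" for f g
      by (rule comb) (use that in \<open>auto simp: tame_def intro: continuous_on_mult\<close>)
    show "\<exists>f. tame f \<and> f x \<noteq> f y" if "x \<in> B \<and> y \<in> B \<and> x \<noteq> y" for x y
      using tame_separates[OF wc] that sub by blast
  qed
  then show thesis using that by blast
qed

lemma dirichlet_solution:
  assumes wc: "weakly_connected V E \<iota> M" and M: "compact M" and B: "B \<noteq> {}"
    and F: "continuous_on B F"
  obtains f where "continuous_on M f" "\<And>x. x \<in> B \<Longrightarrow> f x = F x"
    "harmonic_on_graph V E R (\<lambda>v. f (\<iota> v))"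
proof -
  have "\<exists>f. continuous_on M f \<and> harmonic_on_graph V E R (\<lambda>v. f (\<iota> v)) \<and>
      (\<forall>x\<in>B. \<bar>F x - f x\<bar> < inverse (real (Suc n)))" for n
  proof -
    obtain g where g: "tame g" "\<And>x. x \<in> B \<Longrightarrow> \<bar>F x - g x\<bar> < inverse (real (Suc n))"
      using tame_approximation[OF wc M F, of "inverse (real (Suc n))"] by auto
    obtain f where "continuous_on M f" "\<And>x. x \<in> B \<Longrightarrow> f x = g x"
        "harmonic_on_graph V E R (\<lambda>v. f (\<iota> v))"
      using harmonic_extension_finite_jumps[OF B, of g] g(1) unfolding tame_def by blast
    then show ?thesis using g(2) by (metis (no_types, lifting))
  qed
  then obtain f where f: "\<And>n. continuous_on M (f n)"
      "\<And>n. harmonic_on_graph V E R (\<lambda>v. f n (\<iota> v))"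
      "\<And>n x. x \<in> B \<Longrightarrow> \<bar>F x - f n x\<bar> < inverse (real (Suc n))"
    by metis
  \<comment> \<open>Both solutions are within \<open>inverse (real (Suc k))\<close> of
    \<open>F\<close> on the boundary, hence the factor 2; the maximum principle carries the bound to
    \<open>M\<close>.\<close>
  have close: "\<bar>f m x - f n x\<bar> \<le> 2 * inverse (real (Suc k))"
    if "k \<le> m" "k \<le> n" "x \<in> M" for k m n x
  proof (rule harmonic_difference_bound[OF M B f(1,2) f(1,2) _ that(3)])
    fix y assume y: "y \<in> B"
    have "inverse (real (Suc m)) \<le> inverse (real (Suc k))"
      "inverse (real (Suc n)) \<le> inverse (real (Suc k))"
      using that by (simp_all add: field_simps)
    then show "\<bar>f m y - f n y\<bar> \<le> 2 * inverse (real (Suc k))"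
      using f(3)[OF y, of m] f(3)[OF y, of n] by linarith
  qed
  have "uniformly_Cauchy_on M f"
  proof (rule uniformly_Cauchy_onI)
    fix e :: real assume "0 < e"
    then obtain k where "inverse (real (Suc k)) < e / 2"
      using reals_Archimedean[of "e / 2"] by auto
    then show "\<exists>k. \<forall>x\<in>M. \<forall>m\<ge>k. \<forall>n\<ge>k. dist (f m x) (f n x) < e"
      using close by (intro exI[of _ k]) (fastforce simp: dist_real_def)
  qed
  then obtain l where l: "uniform_limit M f l sequentially"
    using Cauchy_uniformly_convergent uniformly_convergent_on_def by blast
  have lim: "(\<lambda>n. f n x) \<longlonglongrightarrow> l x" if "x \<in> M" for x
    using tendsto_uniform_limitI[OF l that] .
  show thesis
  proof
    show "continuous_on M l"
      by (rule uniform_limit_theorem[OF _ l]) (simp_all add: f(1))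
    show "l x = F x" if "x \<in> B" for x
    proof (rule LIMSEQ_unique[OF lim])
      show "x \<in> M" using that by (simp add: graph_boundary_def)
      show "(\<lambda>n. f n x) \<longlonglongrightarrow> F x"
      proof (rule metric_LIMSEQ_I)
        fix e :: real assume "0 < e"
        then obtain k where k: "inverse (real (Suc k)) < e"
          using reals_Archimedean by blast
        have "dist (f n x) (F x) < e" if "k \<le> n" for n
        proof -
          have "inverse (real (Suc n)) \<le> inverse (real (Suc k))"
            using that by (simp add: field_simps)
          then show ?thesis
            using f(3)[OF \<open>x \<in> B\<close>, of n] k unfolding dist_real_def by linarith
        qed
        then show "\<exists>k. \<forall>n\<ge>k. dist (f n x) (F x) < e" by blast
      qed
    qed
    show "harmonic_on_graph V E R (\<lambda>v. l (\<iota> v))"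
      unfolding harmonic_iff
    proof
      fix v assume v: "v \<in> interior_vertices V E"
      have "v \<in> V" using v interior_vertices_subset by blast
      \<comment> \<open>The balance at \<open>v\<close> is a finite sum, so it passes to pointwise
        limits.\<close>
      have "(\<lambda>n. \<Sum>u\<in>neighbours E v. conductance E R u v * (f n (\<iota> u) - f n (\<iota> v)))
          \<longlonglongrightarrow> (\<Sum>u\<in>neighbours E v. conductance E R u v * (l (\<iota> u) - l (\<iota> v)))"
        by (intro tendsto_intros lim iota_in \<open>v \<in> V\<close>) (auto simp: neighbours_def dest: edgeD)
      moreover have "(\<Sum>u\<in>neighbours E v. conductance E R u v * (f n (\<iota> u) - f n (\<iota> v))) = 0" for n
        using f(2)[of n] v by (simp add: harmonic_iff)
      ultimately show "(\<Sum>u\<in>neighbours E v. conductance E R u v * (l (\<iota> u) - l (\<iota> v))) = 0"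
        by (simp add: LIMSEQ_const_iff)
    qed
  qed
qed

end

theorem theorem4p5:
  fixes V :: "'v set" and E :: "'v set set" and R :: "'v \<Rightarrow> 'v \<Rightarrow> real"
    and \<iota> :: "'v \<Rightarrow> 'b::metric_space" and M :: "'b set" and F :: "'b \<Rightarrow> real"
  assumes "weighted_graph V E R"
    and "connected_graph V E"
    and "graph_completion V E R \<iota> M"
    and "weakly_connected V E \<iota> M"
    and "compact M"
    and "graph_boundary V E \<iota> M \<noteq> {}"
    and "continuous_on (graph_boundary V E \<iota> M) F"
  shows "\<exists>!f. f \<in> extensional M \<and>
              continuous_on M f \<and>
              (\<forall>x\<in>graph_boundary V E \<iota> M. f x = F x) \<and>
              harmonic_on_graph V E R (\<lambda>v. f (\<iota> v))"
proof -
  interpret completed_graph V E R \<iota> M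
    using assms(1-3) by unfold_locales
  obtain f where f: "continuous_on M f" "\<And>x. x \<in> graph_boundary V E \<iota> M \<Longrightarrow> f x = F x"
      "harmonic_on_graph V E R (\<lambda>v. f (\<iota> v))"
    using dirichlet_solution[OF assms(4-7)] by blast
  have sub: "graph_boundary V E \<iota> M \<subseteq> M" by (auto simp: graph_boundary_def)
  show ?thesis
  proof (rule ex_ex1I)
    \<comment> \<open>Restriction fixes the values off \<open>M\<close>, where \<open>f\<close> is
      arbitrary; all vertices lie in \<open>M\<close>, so the balance is unchanged.\<close>
    have "harmonic_on_graph V E R (\<lambda>v. restrict f M (\<iota> v))"
      unfolding harmonic_iff
    proof
      fix v assume v: "v \<in> interior_vertices V E"
      then have "v \<in> V" using interior_vertices_subset by blast
      then have "(\<Sum>u\<in>neighbours E v. conductance E R u v * (restrict f M (\<iota> u) - restrict f M (\<iota> v)))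
          = (\<Sum>u\<in>neighbours E v. conductance E R u v * (f (\<iota> u) - f (\<iota> v)))"
        by (intro sum.cong) (auto simp: neighbours_def iota_in dest: edgeD)
      then show "(\<Sum>u\<in>neighbours E v. conductance E R u v *
          (restrict f M (\<iota> u) - restrict f M (\<iota> v))) = 0"
        using f(3) v by (simp add: harmonic_iff)
    qed
    moreover have "continuous_on M (restrict f M)"
      using f(1) by (simp add: continuous_on_cong[of M M "restrict f M" f])
    ultimately show "\<exists>f. f \<in> extensional M \<and> continuous_on M f \<and>
        (\<forall>x\<in>graph_boundary V E \<iota> M. f x = F x) \<and> harmonic_on_graph V E R (\<lambda>v. f (\<iota> v))"
      using f(2) sub by (intro exI[of _ "restrict f M"]) auto
  next
    fix g h
    assume g: "g \<in> extensional M \<and> continuous_on M g \<and>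
        (\<forall>x\<in>graph_boundary V E \<iota> M. g x = F x) \<and> harmonic_on_graph V E R (\<lambda>v. g (\<iota> v))"
      and h: "h \<in> extensional M \<and> continuous_on M h \<and>
        (\<forall>x\<in>graph_boundary V E \<iota> M. h x = F x) \<and> harmonic_on_graph V E R (\<lambda>v. h (\<iota> v))"
    \<comment> \<open>Equal boundary values allow the difference bound with constant 0.\<close>
    have "g x = h x" if "x \<in> M" for x
      using harmonic_difference_bound[OF assms(5,6), of g h 0 x] g h that by simp
    then show "g = h" using g h by (intro extensionalityI) auto
  qed
qed

end
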